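(* Let $\Lambda$ be a finitely generated Noetherian domain and let $M$ be a finitely generated $\Lambda$-module whose profinite completion $\widehat{M}$ is a cyclic $\widehat{\Lambda}$-module. Then \[ \overline{\operatorname{Ann}_\Lambda(M)} = \operatorname{Ann}_{\widehat{\Lambda}}(\widehat{M}), \] where $\overline{\operatorname{Ann}_\Lambda(M)}$ denotes the closure in $\widehat{\Lambda}$ of (the image of) the ideal $\operatorname{Ann}_\Lambda(M)$ and $\operatorname{Ann}_{\widehat{\Lambda}}(\widehat{M})$ denotes the annihilator of the profinite module $\widehat{M}$ in the profinite ring $\widehat{\Lambda}$.
   Context: Rings are commutative. A commutative ring $\Lambda$ is called finitely generated if it is finitely generated as a $\mathbb{Z}$-algebra. For a $\Lambda$-module $M$, $\widehat{M}$ denotes the $\Lambda$-profinite completion of $M$, i.e. the topological $\Lambda$-module given by the inverse limit of the finite (as sets) quotient $\Lambda$-modules of $M$, each taken with the discrete topology. The profinite completion $\widehat{\Lambda}$ is the profinite ring given by the inverse limit of the quotients of $\Lambda$ by its finite-index ideals, and $\Lambda$ maps to $\widehat{\Lambda}$ canonically. The $\Lambda$-action on $\widehat{M}$ extends uniquely to a continuous $\widehat{\Lambda}$-action, making $\widehat{M}$ a profinite $\widehat{\Lambda}$-module. A module is cyclic if it is generated by a single element. *)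

theory Defs
  imports
    "HOL-Analysis.Analysis"
    "HOL-Algebra.Module"
    "HOL-Algebra.QuotRing"
    "HOL-Algebra.Generated_Rings"
    "HOL-Algebra.Ring_Divisibility"
begin

no_notation eq_closure_of (\<open>closure'_of\<index>\<close>)

section \<open>Finite generation and annihilators\<close>

definition fin_gen_ring :: "('a, 'c) ring_scheme \<Rightarrow> bool"
  where "fin_gen_ring R \<longleftrightarrow> (\<exists>A \<subseteq> carrier R. finite A \<and> carrier R = generate_ring R A)"

definition submodule_span ::
    "('a, 'c) ring_scheme \<Rightarrow> ('a, 'b, 'd) module_scheme \<Rightarrow> 'b set \<Rightarrow> 'b set"
  where "submodule_span R M A = \<Inter> {N. submodule N R M \<and> A \<subseteq> N}"

definition fin_gen_module :: "('a, 'c) ring_scheme \<Rightarrow> ('a, 'b, 'd) module_scheme \<Rightarrow> bool"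
  where "fin_gen_module R M \<longleftrightarrow>
    (\<exists>A \<subseteq> carrier M. finite A \<and> carrier M = submodule_span R M A)"

definition cyclic_module :: "('a, 'c) ring_scheme \<Rightarrow> ('a, 'b, 'd) module_scheme \<Rightarrow> bool"
  where "cyclic_module R M \<longleftrightarrow> (\<exists>m \<in> carrier M. carrier M = submodule_span R M {m})"

definition annihilator :: "('a, 'c) ring_scheme \<Rightarrow> ('a, 'b, 'd) module_scheme \<Rightarrow> 'a set"
  where "annihilator R M = {r \<in> carrier R. \<forall>m \<in> carrier M. r \<odot>\<^bsub>M\<^esub> m = \<zero>\<^bsub>M\<^esub>}"


section \<open>Quotient modules\<close>

text \<open>Module records extend ring records; the multiplicative fields \<open>mult\<close> and \<open>one\<close> play
  no role in the theory of modules and are left unspecified.\<close>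

definition FactModule :: "('a, 'b, 'd) module_scheme \<Rightarrow> 'b set \<Rightarrow> ('a, 'b set) module"
  where "FactModule M N =
    \<lparr>carrier = a_rcosets\<^bsub>M\<^esub> N, mult = undefined, one = undefined, zero = N, add = set_add M,
     smult = (\<lambda>r X. \<Union>x\<in>X. N +>\<^bsub>M\<^esub> (r \<odot>\<^bsub>M\<^esub> x))\<rparr>"


section \<open>Profinite completions\<close>

text \<open>The inverse limit of the quotients of the additive group of \<open>G\<close> by the members of a family
  \<open>S\<close> of subgroups, ordered by inclusion. For \<open>N \<subseteq> N'\<close> the transition map sends a coset \<open>X\<close> of
  \<open>N\<close> to the coset of \<open>N'\<close> containing it, written as a union in the style of
  \<^const>\<open>rcoset_mult\<close>.\<close>

definition lim_carrier :: "('a, 'c) ring_scheme \<Rightarrow> 'a set set \<Rightarrow> ('a set \<Rightarrow> 'a set) set"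
  where "lim_carrier G S =
    {\<phi> \<in> (\<Pi>\<^sub>E N\<in>S. a_rcosets\<^bsub>G\<^esub> N).
      \<forall>N\<in>S. \<forall>N'\<in>S. N \<subseteq> N' \<longrightarrow> \<phi> N' = (\<Union>x\<in>\<phi> N. N' +>\<^bsub>G\<^esub> x)}"

definition lim_topology :: "('a, 'c) ring_scheme \<Rightarrow> 'a set set \<Rightarrow> ('a set \<Rightarrow> 'a set) topology"
  where "lim_topology G S =
    subtopology (product_topology (\<lambda>N. discrete_topology (a_rcosets\<^bsub>G\<^esub> N)) S) (lim_carrier G S)"

definition to_lim :: "('a, 'c) ring_scheme \<Rightarrow> 'a set set \<Rightarrow> 'a \<Rightarrow> 'a set \<Rightarrow> 'a set"
  where "to_lim G S x = (\<lambda>N\<in>S. N +>\<^bsub>G\<^esub> x)"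

definition fin_ideals :: "('a, 'c) ring_scheme \<Rightarrow> 'a set set"
  where "fin_ideals R = {I. ideal I R \<and> finite (carrier (R Quot I))}"

definition ring_completion :: "('a, 'c) ring_scheme \<Rightarrow> ('a set \<Rightarrow> 'a set) ring"
  where "ring_completion R =
    \<lparr>carrier = lim_carrier R (fin_ideals R),
     mult = (\<lambda>x y. \<lambda>I\<in>fin_ideals R. x I \<otimes>\<^bsub>R Quot I\<^esub> y I),
     one = (\<lambda>I\<in>fin_ideals R. \<one>\<^bsub>R Quot I\<^esub>),
     zero = (\<lambda>I\<in>fin_ideals R. \<zero>\<^bsub>R Quot I\<^esub>),
     add = (\<lambda>x y. \<lambda>I\<in>fin_ideals R. x I \<oplus>\<^bsub>R Quot I\<^esub> y I)\<rparr>"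

abbreviation ring_completion_topology :: "('a, 'c) ring_scheme \<Rightarrow> ('a set \<Rightarrow> 'a set) topology"
  where "ring_completion_topology R \<equiv> lim_topology R (fin_ideals R)"

abbreviation to_ring_completion :: "('a, 'c) ring_scheme \<Rightarrow> 'a \<Rightarrow> 'a set \<Rightarrow> 'a set"
  where "to_ring_completion R \<equiv> to_lim R (fin_ideals R)"

definition fin_submodules ::
    "('a, 'c) ring_scheme \<Rightarrow> ('a, 'b, 'd) module_scheme \<Rightarrow> 'b set set"
  where "fin_submodules R M = {N. submodule N R M \<and> finite (carrier (FactModule M N))}"

text \<open>An element \<open>x\<close> of the completed ring acts on a finite quotient \<open>M/N\<close> through its component
  at the ideal \<open>I = annihilator R (M/N)\<close>, which has finite index: any representative \<open>r\<close> of the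
  coset \<open>x I\<close> acts on \<open>M/N\<close> in the same way, and the union over all \<open>r\<close> is this common value.
  The lemmas \<open>smult_to_ring_completion\<close>, \<open>continuous_smult_completion\<close> and
  \<open>smult_completion_unique\<close> below show that this is the unique continuous extension of the
  action of \<open>R\<close>.\<close>

definition module_completion ::
    "('a, 'c) ring_scheme \<Rightarrow> ('a, 'b, 'd) module_scheme \<Rightarrow>
     ('a set \<Rightarrow> 'a set, 'b set \<Rightarrow> 'b set) module"
  where "module_completion R M =
    \<lparr>carrier = lim_carrier M (fin_submodules R M),
     mult = undefined,
     one = undefined,
     zero = (\<lambda>N\<in>fin_submodules R M. \<zero>\<^bsub>FactModule M N\<^esub>),
     add = (\<lambda>u v. \<lambda>N\<in>fin_submodules R M. u N \<oplus>\<^bsub>FactModule M N\<^esub> v N),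
     smult = (\<lambda>x u. \<lambda>N\<in>fin_submodules R M.
       \<Union>r\<in>x (annihilator R (FactModule M N)). r \<odot>\<^bsub>FactModule M N\<^esub> u N)\<rparr>"

abbreviation module_completion_topology ::
    "('a, 'c) ring_scheme \<Rightarrow> ('a, 'b, 'd) module_scheme \<Rightarrow> ('b set \<Rightarrow> 'b set) topology"
  where "module_completion_topology R M \<equiv> lim_topology M (fin_submodules R M)"


section \<open>Basic facts\<close>

subsection \<open>Inverse limits of coset spaces\<close>

lemma lim_carrierD:
  assumes "\<phi> \<in> lim_carrier G S"
  shows "\<phi> \<in> extensional S"
    and "N \<in> S \<Longrightarrow> \<phi> N \<in> a_rcosets\<^bsub>G\<^esub> N"
    and "\<lbrakk>N \<in> S; N' \<in> S; N \<subseteq> N'\<rbrakk> \<Longrightarrow> \<phi> N' = (\<Union>x\<in>\<phi> N. N' +>\<^bsub>G\<^esub> x)"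
proof -
  note D = assms[unfolded lim_carrier_def, THEN CollectD]
  show "\<phi> \<in> extensional S" "N \<in> S \<Longrightarrow> \<phi> N \<in> a_rcosets\<^bsub>G\<^esub> N"
    using D[THEN conjunct1] by (simp_all add: PiE_iff)
  show "\<lbrakk>N \<in> S; N' \<in> S; N \<subseteq> N'\<rbrakk> \<Longrightarrow> \<phi> N' = (\<Union>x\<in>\<phi> N. N' +>\<^bsub>G\<^esub> x)"
    using D[THEN conjunct2, rule_format] .
qed

lemma lim_carrier_subset: "lim_carrier G S \<subseteq> (\<Pi>\<^sub>E N\<in>S. a_rcosets\<^bsub>G\<^esub> N)"
  unfolding lim_carrier_def by (rule Collect_restrict)

lemma topspace_lim_topology [simp]: "topspace (lim_topology G S) = lim_carrier G S"
  unfolding lim_topology_def by (simp add: Int_absorb1 lim_carrier_subset)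

context abelian_group
begin

lemma transition_coset:
  assumes "additive_subgroup N G" "additive_subgroup N' G" "N \<subseteq> N'" "a \<in> carrier G"
  shows "(\<Union>x\<in>N +> a. N' +> x) = N' +> a"
proof -
  interpret N: abelian_subgroup N G
    using assms abelian_subgroupI3 abelian_group_axioms by blast
  interpret N': abelian_subgroup N' G
    using assms abelian_subgroupI3 abelian_group_axioms by blast
  have "N' +> x = N' +> a" if "x \<in> N +> a" for x
  proof -
    have "x \<in> carrier G"
      using that assms N.a_elemrcos_carrier by blast
    moreover have "x \<oplus> \<ominus> a \<in> N'"
      using N.a_rcos_module_imp[OF assms(4) that] assms(3) by blast
    ultimately have "x \<in> N' +> a"
      using assms(4) N'.a_rcos_module_rev by blast
    then show ?thesis
      using N'.a_repr_independence' assms(4) by blast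
  qed
  moreover have "a \<in> N +> a"
    using N.a_rcos_self assms(4) by blast
  ultimately show ?thesis by blast
qed

lemma lim_carrierI:
  assumes S: "\<And>N. N \<in> S \<Longrightarrow> additive_subgroup N G"
    and \<phi>: "\<And>N N'. \<lbrakk>N \<in> S; N' \<in> S; N \<subseteq> N'\<rbrakk> \<Longrightarrow>
      \<exists>a\<in>carrier G. \<phi> N = N +> a \<and> \<phi> N' = N' +> a"
  shows "restrict \<phi> S \<in> lim_carrier G S"
proof -
  have cosets: "\<phi> N \<in> a_rcosets N" if N: "N \<in> S" for N
  proof -
    obtain a where "a \<in> carrier G" "\<phi> N = N +> a"
      using \<phi>[OF N N] by blast
    then show ?thesis
      using a_rcosetsI[OF additive_subgroup.a_subset[OF S[OF N]]] by simp
  qed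
  have trans: "\<phi> N' = (\<Union>x\<in>\<phi> N. N' +> x)" if N: "N \<in> S" "N' \<in> S" "N \<subseteq> N'" for N N'
  proof -
    obtain a where "a \<in> carrier G" "\<phi> N = N +> a" "\<phi> N' = N' +> a"
      using \<phi>[OF N] by blast
    then show ?thesis
      using transition_coset[OF S[OF N(1)] S[OF N(2)] N(3)] by simp
  qed
  show ?thesis
    unfolding lim_carrier_def
  proof (intro CollectI conjI ballI impI)
    show "restrict \<phi> S \<in> (\<Pi>\<^sub>E N\<in>S. a_rcosets N)"
      unfolding restrict_PiE_iff by (intro ballI cosets)
  next
    fix N N' assume N: "N \<in> S" "N' \<in> S" "N \<subseteq> N'"
    show "restrict \<phi> S N' = (\<Union>x\<in>restrict \<phi> S N. N' +> x)"
      unfolding restrict_apply'[OF N(1)] restrict_apply'[OF N(2)] by (rule trans[OF N])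
  qed
qed

lemma lim_carrierE:
  assumes S: "\<And>N. N \<in> S \<Longrightarrow> additive_subgroup N G"
    and "\<phi> \<in> lim_carrier G S" "N \<in> S" "N' \<in> S" "N \<subseteq> N'"
  obtains a where "a \<in> carrier G" "\<phi> N = N +> a" "\<phi> N' = N' +> a"
proof -
  have "\<phi> N \<in> a_rcosets N" "\<phi> N' = (\<Union>x\<in>\<phi> N. N' +> x)"
    using lim_carrierD(2)[OF assms(2,3)] lim_carrierD(3)[OF assms(2-5)] .
  then obtain a where "a \<in> carrier G" "\<phi> N = N +> a"
    by (auto simp: A_RCOSETS_def RCOSETS_def a_r_coset_def)
  then show thesis
    using that \<open>\<phi> N' = _\<close> transition_coset[OF S[OF assms(3)] S[OF assms(4)] assms(5)] by simp
qed

lemma lim_carrier_coset: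
  assumes "\<And>N. N \<in> S \<Longrightarrow> additive_subgroup N G" "\<phi> \<in> lim_carrier G S" "N \<in> S"
  obtains a where "a \<in> carrier G" "\<phi> N = N +> a"
  by (rule lim_carrierE[OF assms(1) assms(2,3,3) subset_refl]) (assumption, rule that)

lemma lim_carrier_eqI:
  assumes "\<phi> \<in> lim_carrier G S" "\<psi> \<in> lim_carrier G S" "\<And>N. N \<in> S \<Longrightarrow> \<phi> N = \<psi> N"
  shows "\<phi> = \<psi>"
  using lim_carrierD(1)[OF assms(1)] lim_carrierD(1)[OF assms(2)] assms(3) by (rule extensionalityI)

lemma to_lim_closed:
  assumes "\<And>N. N \<in> S \<Longrightarrow> additive_subgroup N G" "a \<in> carrier G"
  shows "to_lim G S a \<in> lim_carrier G S"
  unfolding to_lim_def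
  by (rule lim_carrierI[OF assms(1)]) (assumption, intro bexI[OF _ assms(2)] conjI refl)

text \<open>If the index family is closed under finite intersections, then \<open>G\<close> is dense in the limit.\<close>

lemma to_lim_dense:
  assumes S: "\<And>N. N \<in> S \<Longrightarrow> additive_subgroup N G"
    and top: "carrier G \<in> S"
    and inter: "\<And>N N'. \<lbrakk>N \<in> S; N' \<in> S\<rbrakk> \<Longrightarrow> N \<inter> N' \<in> S"
  shows "lim_topology G S closure_of (to_lim G S ` carrier G) = lim_carrier G S"
proof
  show "lim_topology G S closure_of (to_lim G S ` carrier G) \<subseteq> lim_carrier G S"
    using closure_of_subset_topspace[of "lim_topology G S"] by simp
  show "lim_carrier G S \<subseteq> lim_topology G S closure_of (to_lim G S ` carrier G)"
  proof
    fix \<phi> assume \<phi>: "\<phi> \<in> lim_carrier G S"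
    have "\<exists>y\<in>to_lim G S ` carrier G. y \<in> T"
      if T: "\<phi> \<in> T" "openin (lim_topology G S) T" for T
    proof -
      obtain U where U: "openin (product_topology (\<lambda>N. discrete_topology (a_rcosets N)) S) U"
          "T = U \<inter> lim_carrier G S"
        using T(2)[unfolded lim_topology_def openin_subtopology] by (elim exE conjE)
      have "\<phi> \<in> U" using T(1) unfolding U(2) by (rule IntD1)
      obtain X where X: "\<phi> \<in> (\<Pi>\<^sub>E N\<in>S. X N)" "finite {N \<in> S. X N \<noteq> a_rcosets N}"
          "(\<Pi>\<^sub>E N\<in>S. X N) \<subseteq> U"
        using U(1)[unfolded openin_product_topology_alt topspace_discrete_topology, rule_format, of \<phi>,
            OF \<open>\<phi> \<in> U\<close>]
        by (elim exE conjE)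
      define F where "F = {N \<in> S. X N \<noteq> a_rcosets N}"
      have "\<exists>K\<in>S. \<forall>N\<in>F. K \<subseteq> N" if "finite F" "F \<subseteq> S" for F
        using that
      proof (induction F rule: finite_induct)
        case empty
        show ?case using top by auto
      next
        case (insert N F)
        then obtain K where "K \<in> S" "\<forall>N\<in>F. K \<subseteq> N" by auto
        then show ?case
          using insert.prems inter by (intro bexI[of _ "K \<inter> N"]) auto
      qed
      then obtain K where K: "K \<in> S" "\<And>N. N \<in> F \<Longrightarrow> K \<subseteq> N"
        using X(2) unfolding F_def by (metis (no_types, lifting) F_def mem_Collect_eq subsetI)
      obtain a where a: "a \<in> carrier G" "\<phi> K = K +> a"
        by (rule lim_carrier_coset[OF S \<phi> K(1)])
      have \<phi>_eq: "\<phi> N = N +> a" if N: "N \<in> F" for N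
      proof -
        have "N \<in> S" using N by (simp add: F_def)
        have "\<phi> N = (\<Union>x\<in>\<phi> K. N +> x)"
          by (rule lim_carrierD(3)[OF \<phi> K(1) \<open>N \<in> S\<close> K(2)[OF N]])
        then show ?thesis
          unfolding a(2) transition_coset[OF S[OF K(1)] S[OF \<open>N \<in> S\<close>] K(2)[OF N] a(1)] .
      qed
      have in_X: "N +> a \<in> X N" if N: "N \<in> S" for N
      proof (cases "N \<in> F")
        case True
        show ?thesis
          using PiE_mem[OF X(1) N] unfolding \<phi>_eq[OF True] .
      next
        case False
        then have "X N = a_rcosets N"
          using N by (simp add: F_def)
        then show ?thesis
          using a_rcosetsI[OF additive_subgroup.a_subset[OF S[OF N]] a(1)] by simp
      qed
      have "to_lim G S a \<in> (\<Pi>\<^sub>E N\<in>S. X N)"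
        unfolding to_lim_def restrict_PiE_iff by (intro ballI in_X)
      then have "to_lim G S a \<in> T"
        unfolding U(2) by (intro IntI subsetD[OF X(3)] to_lim_closed[OF S a(1)])
      then show ?thesis
        using a(1) by blast
    qed
    then show "\<phi> \<in> lim_topology G S closure_of (to_lim G S ` carrier G)"
      using \<phi> unfolding in_closure_of topspace_lim_topology by blast
  qed
qed

end

lemma Hausdorff_lim_topology: "Hausdorff_space (lim_topology G S)"
  unfolding lim_topology_def
  by (rule Hausdorff_space_subtopology) (simp add: Hausdorff_space_product_topology)

lemma continuous_map_lim_component:
  assumes "N \<in> S"
  shows "continuous_map (lim_topology G S) (discrete_topology (a_rcosets\<^bsub>G\<^esub> N)) (\<lambda>\<phi>. \<phi> N)"
  unfolding lim_topology_def
  by (rule continuous_map_from_subtopology, rule continuous_map_product_projection[OF assms])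

subsection \<open>Quotient modules and annihilators\<close>

lemma a_rcosets_iff: "X \<in> a_rcosets\<^bsub>G\<^esub> N \<longleftrightarrow> (\<exists>a\<in>carrier G. X = N +>\<^bsub>G\<^esub> a)"
  by (auto simp: A_RCOSETS_def RCOSETS_def a_r_coset_def)

lemma FactModule_simps [simp]:
  "carrier (FactModule M N) = a_rcosets\<^bsub>M\<^esub> N"
  "\<zero>\<^bsub>FactModule M N\<^esub> = N"
  "X \<oplus>\<^bsub>FactModule M N\<^esub> Y = X <+>\<^bsub>M\<^esub> Y"
  "r \<odot>\<^bsub>FactModule M N\<^esub> X = (\<Union>x\<in>X. N +>\<^bsub>M\<^esub> (r \<odot>\<^bsub>M\<^esub> x))"
  by (simp_all add: FactModule_def)

lemma submodule_additive_subgroup: "submodule N R M \<Longrightarrow> additive_subgroup N M"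
  by (simp add: submodule_def additive_subgroup_def)

context Module.module
begin

lemma submodule_abelian_subgroup: "submodule N R M \<Longrightarrow> abelian_subgroup N M"
  using submodule_additive_subgroup abelian_subgroupI3 M.abelian_group_axioms by blast

lemma FactModule_smult:
  assumes N: "submodule N R M" and r: "r \<in> carrier R" and a: "a \<in> carrier M"
  shows "r \<odot>\<^bsub>FactModule M N\<^esub> (N +>\<^bsub>M\<^esub> a) = N +>\<^bsub>M\<^esub> (r \<odot>\<^bsub>M\<^esub> a)"
proof -
  interpret N: abelian_subgroup N M
    by (rule submodule_abelian_subgroup[OF N])
  have "N +>\<^bsub>M\<^esub> (r \<odot>\<^bsub>M\<^esub> x) = N +>\<^bsub>M\<^esub> (r \<odot>\<^bsub>M\<^esub> a)" if x: "x \<in> N +>\<^bsub>M\<^esub> a" for x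
  proof -
    have xM: "x \<in> carrier M"
      by (rule N.a_elemrcos_carrier[OF a x])
    have "x \<oplus>\<^bsub>M\<^esub> \<ominus>\<^bsub>M\<^esub> a \<in> N"
      by (rule N.a_rcos_module_imp[OF a x])
    then have "r \<odot>\<^bsub>M\<^esub> (x \<oplus>\<^bsub>M\<^esub> \<ominus>\<^bsub>M\<^esub> a) \<in> N"
      by (rule submodule.smult_closed[OF N r])
    then have "r \<odot>\<^bsub>M\<^esub> x \<oplus>\<^bsub>M\<^esub> \<ominus>\<^bsub>M\<^esub> (r \<odot>\<^bsub>M\<^esub> a) \<in> N"
      using r a xM by (simp add: smult_r_distr smult_r_minus)
    then have "r \<odot>\<^bsub>M\<^esub> x \<in> N +>\<^bsub>M\<^esub> (r \<odot>\<^bsub>M\<^esub> a)"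
      using r a xM by (intro N.a_rcos_module_rev) auto
    then show ?thesis
      using N.a_repr_independence' r a by blast
  qed
  moreover have "a \<in> N +>\<^bsub>M\<^esub> a"
    by (rule N.a_rcos_self[OF a])
  ultimately show ?thesis
    unfolding FactModule_simps by blast
qed

lemma FactModule_is_module:
  assumes N: "submodule N R M"
  shows "Module.module R (FactModule M N)"
proof -
  interpret N: abelian_subgroup N M
    by (rule submodule_abelian_subgroup[OF N])
  have 1: "abelian_group (FactModule M N)"
  proof (rule abelian_groupI, goal_cases)
    case (6 X)
    then obtain a where a: "a \<in> carrier M" "X = N +>\<^bsub>M\<^esub> a"
      by (auto simp: a_rcosets_iff)
    then have "(N +>\<^bsub>M\<^esub> \<ominus>\<^bsub>M\<^esub> a) <+>\<^bsub>M\<^esub> X = N"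
      using M.a_coset_add_zero[OF N.a_subset] by (simp add: N.a_rcos_sum M.l_neg)
    moreover have "N +>\<^bsub>M\<^esub> \<ominus>\<^bsub>M\<^esub> a \<in> a_rcosets\<^bsub>M\<^esub> N"
      using a(1) by (intro M.a_rcosetsI[OF N.a_subset]) simp
    ultimately show ?case
      unfolding FactModule_simps by blast
  next
    case 2
    then show ?case
      using M.a_coset_add_zero[OF N.a_subset] by (auto simp: a_rcosets_iff intro!: bexI[of _ "\<zero>\<^bsub>M\<^esub>"])
  next
    case (5 X)
    then show ?case
      using N.rcosets_add_eq by simp
  qed (auto simp: a_rcosets_iff N.a_rcos_sum M.a_ac)
  show ?thesis
  proof (rule moduleI[OF R.is_cring 1], goal_cases)
    case (1 a x)
    then show ?case
      using M.a_rcosetsI[OF N.a_subset]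
      by (auto simp: a_rcosets_iff[of x] FactModule_smult[OF N] simp del: FactModule_simps(4))
  next
    case (2 a b x)
    then show ?case
      by (auto simp: a_rcosets_iff FactModule_smult[OF N] N.a_rcos_sum smult_l_distr
          simp del: FactModule_simps(4))
  next
    case (3 a x y)
    then show ?case
      by (auto simp: a_rcosets_iff FactModule_smult[OF N] N.a_rcos_sum smult_r_distr
          simp del: FactModule_simps(4))
  next
    case (4 a b x)
    then show ?case
      by (auto simp: a_rcosets_iff FactModule_smult[OF N] smult_assoc1 simp del: FactModule_simps(4))
  next
    case (5 x)
    then show ?case
      by (auto simp: a_rcosets_iff FactModule_smult[OF N] simp del: FactModule_simps(4))
  qed
qed

lemma annihilator_ideal: "ideal (annihilator R M) R"
proof (rule idealI[OF R.ring_axioms])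
  show "subgroup (annihilator R M) (add_monoid R)"
    by (rule group.subgroupI[OF R.a_group])
      (auto simp: annihilator_def smult_l_distr smult_l_minus
        simp flip: a_inv_def intro!: exI[of _ "\<zero>\<^bsub>R\<^esub>"])
  show "x \<otimes>\<^bsub>R\<^esub> a \<in> annihilator R M" if "a \<in> annihilator R M" "x \<in> carrier R" for a x
    using that by (auto simp: annihilator_def smult_assoc1)
  then show "a \<otimes>\<^bsub>R\<^esub> x \<in> annihilator R M" if "a \<in> annihilator R M" "x \<in> carrier R" for a x
    using that R.m_comm[of a x] by (auto simp: annihilator_def)
qed

lemma annihilator_coset_smult:
  assumes r: "r \<in> carrier R" and s: "s \<in> annihilator R M +>\<^bsub>R\<^esub> r" and m: "m \<in> carrier M"
  shows "s \<odot>\<^bsub>M\<^esub> m = r \<odot>\<^bsub>M\<^esub> m"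
proof -
  obtain t where t: "t \<in> annihilator R M" "s = t \<oplus>\<^bsub>R\<^esub> r"
    using s by (auto simp: a_r_coset_def r_coset_def)
  then have "s \<odot>\<^bsub>M\<^esub> m = t \<odot>\<^bsub>M\<^esub> m \<oplus>\<^bsub>M\<^esub> r \<odot>\<^bsub>M\<^esub> m"
    using r m by (simp add: annihilator_def smult_l_distr)
  then show ?thesis
    using t r m by (simp add: annihilator_def)
qed

lemma finite_annihilator_quotient:
  assumes "finite (carrier M)"
  shows "annihilator R M \<in> fin_ideals R"
proof -
  interpret I: ideal "annihilator R M" R
    by (rule annihilator_ideal)
  define act where "act r = (\<lambda>m\<in>carrier M. r \<odot>\<^bsub>M\<^esub> m)" for r
  have coset: "annihilator R M +>\<^bsub>R\<^esub> r = {s \<in> carrier R. act s = act r}" if r: "r \<in> carrier R" for r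
  proof (intro equalityI subsetI)
    fix s assume s: "s \<in> annihilator R M +>\<^bsub>R\<^esub> r"
    then show "s \<in> {s \<in> carrier R. act s = act r}"
      using annihilator_coset_smult[OF r s] I.a_elemrcos_carrier[OF r s]
      by (auto simp: act_def intro!: restrict_ext)
  next
    fix s assume "s \<in> {s \<in> carrier R. act s = act r}"
    then have s: "s \<in> carrier R" "act s = act r" by auto
    have "(s \<oplus>\<^bsub>R\<^esub> \<ominus>\<^bsub>R\<^esub> r) \<odot>\<^bsub>M\<^esub> m = \<zero>\<^bsub>M\<^esub>" if m: "m \<in> carrier M" for m
    proof -
      have "s \<odot>\<^bsub>M\<^esub> m = r \<odot>\<^bsub>M\<^esub> m"
        using fun_cong[OF s(2), of m] m by (simp add: act_def)
      then show ?thesis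
        using s(1) r m by (simp add: smult_l_distr smult_l_minus M.r_neg)
    qed
    then have "s \<oplus>\<^bsub>R\<^esub> \<ominus>\<^bsub>R\<^esub> r \<in> annihilator R M"
      unfolding annihilator_def using s(1) r by simp
    then show "s \<in> annihilator R M +>\<^bsub>R\<^esub> r"
      by (rule I.a_rcos_module_rev[OF r s(1)])
  qed
  have "act ` carrier R \<subseteq> (carrier M \<rightarrow>\<^sub>E carrier M)"
    by (auto simp: act_def)
  then have "finite (act ` carrier R)"
    by (rule finite_subset) (intro finite_PiE assms)
  then have "finite ((\<lambda>f. {s \<in> carrier R. act s = f}) ` act ` carrier R)"
    by (rule finite_imageI)
  moreover have "carrier (R Quot annihilator R M) \<subseteq> (\<lambda>f. {s \<in> carrier R. act s = f}) ` act ` carrier R"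
  proof
    fix X assume "X \<in> carrier (R Quot annihilator R M)"
    then obtain r where "r \<in> carrier R" "X = annihilator R M +>\<^bsub>R\<^esub> r"
      by (auto simp: FactRing_def a_rcosets_iff)
    then show "X \<in> (\<lambda>f. {s \<in> carrier R. act s = f}) ` act ` carrier R"
      using coset by simp
  qed
  ultimately show ?thesis
    unfolding fin_ideals_def by (intro CollectI conjI I.ideal_axioms) (rule finite_subset)
qed

lemma fin_submodules_annihilator:
  assumes "N \<in> fin_submodules R M"
  shows "annihilator R (FactModule M N) \<in> fin_ideals R"
  using assms FactModule_is_module module.finite_annihilator_quotient
  unfolding fin_submodules_def by blast

end


subsection \<open>The completed ring\<close>

lemma fin_ideals_ideal: "I \<in> fin_ideals R \<Longrightarrow> ideal I R"
  by (simp add: fin_ideals_def)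

lemma fin_ideals_subgroup: "I \<in> fin_ideals R \<Longrightarrow> additive_subgroup I R"
  by (simp add: fin_ideals_def ideal.axioms(1))

lemma ring_completion_simps [simp]:
  "carrier (ring_completion R) = lim_carrier R (fin_ideals R)"
  "\<one>\<^bsub>ring_completion R\<^esub> = (\<lambda>I\<in>fin_ideals R. \<one>\<^bsub>R Quot I\<^esub>)"
  "\<zero>\<^bsub>ring_completion R\<^esub> = (\<lambda>I\<in>fin_ideals R. \<zero>\<^bsub>R Quot I\<^esub>)"
  "x \<otimes>\<^bsub>ring_completion R\<^esub> y = (\<lambda>I\<in>fin_ideals R. x I \<otimes>\<^bsub>R Quot I\<^esub> y I)"
  "x \<oplus>\<^bsub>ring_completion R\<^esub> y = (\<lambda>I\<in>fin_ideals R. x I \<oplus>\<^bsub>R Quot I\<^esub> y I)"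
  by (simp_all add: ring_completion_def)

context ring
begin

lemma fin_ideals_Int:
  assumes "I \<in> fin_ideals R" "J \<in> fin_ideals R"
  shows "I \<inter> J \<in> fin_ideals R"
proof -
  interpret I: ideal I R by (rule fin_ideals_ideal[OF assms(1)])
  interpret J: ideal J R by (rule fin_ideals_ideal[OF assms(2)])
  have id: "ideal (I \<inter> J) R"
    using i_intersect I.ideal_axioms J.ideal_axioms by blast
  interpret IJ: ideal "I \<inter> J" R by (rule id)
  have "X \<in> (\<lambda>(X, Y). X \<inter> Y) ` ((a_rcosets I) \<times> (a_rcosets J))" if X: "X \<in> a_rcosets (I \<inter> J)" for X
  proof -
    obtain a where a: "a \<in> carrier R" "X = (I \<inter> J) +> a"
      using X unfolding a_rcosets_iff by (elim bexE)
    have "(I \<inter> J) +> a = (I +> a) \<inter> (J +> a)"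
    proof (intro equalityI subsetI)
      fix x assume x: "x \<in> (I \<inter> J) +> a"
      then show "x \<in> (I +> a) \<inter> (J +> a)"
        by (auto simp: a_r_coset_def r_coset_def)
    next
      fix x assume x: "x \<in> (I +> a) \<inter> (J +> a)"
      then have "x \<in> carrier R"
        using I.a_elemrcos_carrier[OF a(1)] by (elim IntE)
      then show "x \<in> (I \<inter> J) +> a"
        using x I.a_rcos_module[OF a(1)] J.a_rcos_module[OF a(1)] IJ.a_rcos_module[OF a(1)] by simp
    qed
    then have "X = (\<lambda>(X, Y). X \<inter> Y) (I +> a, J +> a)"
      using a(2) by simp
    then show ?thesis
      by (rule image_eqI) (intro SigmaI a_rcosetsI I.a_subset J.a_subset a(1))
  qed
  then have "carrier (R Quot (I \<inter> J)) \<subseteq> (\<lambda>(X, Y). X \<inter> Y) ` ((a_rcosets I) \<times> (a_rcosets J))"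
    by (simp add: FactRing_def subsetI)
  moreover have "finite ((a_rcosets I) \<times> (a_rcosets J))"
    using assms by (simp add: fin_ideals_def FactRing_def)
  ultimately show ?thesis
    unfolding fin_ideals_def by (intro CollectI conjI id) (rule finite_subset, assumption, rule finite_imageI)
qed

lemma carrier_fin_ideals: "carrier R \<in> fin_ideals R"
proof -
  have "carrier R +> a = carrier R" if "a \<in> carrier R" for a
    using that by (intro a_coset_join2 add.subgroup_self) auto
  then have "a_rcosets (carrier R) \<subseteq> {carrier R}"
    by (auto simp: a_rcosets_iff)
  then show ?thesis
    unfolding fin_ideals_def FactRing_def using oneideal by (auto intro: finite_subset)
qed

lemma ring_completion_dense:
  "ring_completion_topology R closure_of (to_ring_completion R ` carrier R) =
    carrier (ring_completion R)"
  unfolding ring_completion_simps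
  by (rule to_lim_dense[OF fin_ideals_subgroup carrier_fin_ideals fin_ideals_Int])

lemma to_ring_completion_closed:
  "r \<in> carrier R \<Longrightarrow> to_ring_completion R r \<in> carrier (ring_completion R)"
  unfolding ring_completion_simps by (rule to_lim_closed[OF fin_ideals_subgroup])

lemma to_ring_completion_apply: "I \<in> fin_ideals R \<Longrightarrow> to_ring_completion R r I = I +> r"
  by (simp add: to_lim_def)

lemma Quot_coset_simps:
  assumes "ideal I R" "a \<in> carrier R" "b \<in> carrier R"
  shows "(I +> a) \<oplus>\<^bsub>R Quot I\<^esub> (I +> b) = I +> (a \<oplus> b)"
    and "(I +> a) \<otimes>\<^bsub>R Quot I\<^esub> (I +> b) = I +> (a \<otimes> b)"
    and "\<one>\<^bsub>R Quot I\<^esub> = I +> \<one>"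
    and "\<zero>\<^bsub>R Quot I\<^esub> = I +> \<zero>"
proof -
  interpret ideal I R by (rule assms(1))
  show "(I +> a) \<oplus>\<^bsub>R Quot I\<^esub> (I +> b) = I +> (a \<oplus> b)"
      "(I +> a) \<otimes>\<^bsub>R Quot I\<^esub> (I +> b) = I +> (a \<otimes> b)"
      "\<one>\<^bsub>R Quot I\<^esub> = I +> \<one>" "\<zero>\<^bsub>R Quot I\<^esub> = I +> \<zero>"
    using assms(2,3) a_coset_add_zero[OF a_subset]
    by (simp_all add: FactRing_def a_rcos_sum rcoset_mult_add)
qed

lemma ring_completion_coset:
  assumes "x \<in> carrier (ring_completion R)" "I \<in> fin_ideals R"
  obtains a where "a \<in> carrier R" "x I = I +> a"
  by (rule lim_carrier_coset[OF fin_ideals_subgroup assms(1)[unfolded ring_completion_simps] assms(2)])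
    (assumption, rule that)

lemma ring_completion_coset2:
  assumes "x \<in> carrier (ring_completion R)" "I \<in> fin_ideals R" "J \<in> fin_ideals R" "I \<subseteq> J"
  obtains a where "a \<in> carrier R" "x I = I +> a" "x J = J +> a"
  by (rule lim_carrierE[OF fin_ideals_subgroup assms(1)[unfolded ring_completion_simps] assms(2-4)])
    (assumption, rule that)

lemma ring_completionI:
  assumes "\<And>I J. \<lbrakk>I \<in> fin_ideals R; J \<in> fin_ideals R; I \<subseteq> J\<rbrakk> \<Longrightarrow>
      \<exists>a\<in>carrier R. \<phi> I = I +> a \<and> \<phi> J = J +> a"
  shows "restrict \<phi> (fin_ideals R) \<in> carrier (ring_completion R)"
  unfolding ring_completion_simps by (rule lim_carrierI[OF fin_ideals_subgroup assms])

lemma ring_completion_eqI: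
  assumes "x \<in> carrier (ring_completion R)" "y \<in> carrier (ring_completion R)"
    and "\<And>I. I \<in> fin_ideals R \<Longrightarrow> x I = y I"
  shows "x = y"
  using assms unfolding ring_completion_simps by (rule lim_carrier_eqI)

lemma ring_completion_closed:
  assumes x: "x \<in> carrier (ring_completion R)" and y: "y \<in> carrier (ring_completion R)"
  shows "x \<oplus>\<^bsub>ring_completion R\<^esub> y \<in> carrier (ring_completion R)"
    and "x \<otimes>\<^bsub>ring_completion R\<^esub> y \<in> carrier (ring_completion R)"
    and "\<one>\<^bsub>ring_completion R\<^esub> \<in> carrier (ring_completion R)"
    and "\<zero>\<^bsub>ring_completion R\<^esub> \<in> carrier (ring_completion R)"
proof -
  show "x \<oplus>\<^bsub>ring_completion R\<^esub> y \<in> carrier (ring_completion R)"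
    unfolding ring_completion_simps(5)
  proof (rule ring_completionI)
    fix I J assume I: "I \<in> fin_ideals R" and J: "J \<in> fin_ideals R" and IJ: "I \<subseteq> J"
    obtain a where a: "a \<in> carrier R" "x I = I +> a" "x J = J +> a"
      by (rule ring_completion_coset2[OF x I J IJ])
    obtain b where b: "b \<in> carrier R" "y I = I +> b" "y J = J +> b"
      by (rule ring_completion_coset2[OF y I J IJ])
    show "\<exists>c\<in>carrier R. x I \<oplus>\<^bsub>R Quot I\<^esub> y I = I +> c \<and> x J \<oplus>\<^bsub>R Quot J\<^esub> y J = J +> c"
      unfolding a b using a(1) b(1) fin_ideals_ideal[OF I] fin_ideals_ideal[OF J]
      by (intro bexI[of _ "a \<oplus> b"] conjI Quot_coset_simps) auto
  qed
  show "x \<otimes>\<^bsub>ring_completion R\<^esub> y \<in> carrier (ring_completion R)"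
    unfolding ring_completion_simps(4)
  proof (rule ring_completionI)
    fix I J assume I: "I \<in> fin_ideals R" and J: "J \<in> fin_ideals R" and IJ: "I \<subseteq> J"
    obtain a where a: "a \<in> carrier R" "x I = I +> a" "x J = J +> a"
      by (rule ring_completion_coset2[OF x I J IJ])
    obtain b where b: "b \<in> carrier R" "y I = I +> b" "y J = J +> b"
      by (rule ring_completion_coset2[OF y I J IJ])
    show "\<exists>c\<in>carrier R. x I \<otimes>\<^bsub>R Quot I\<^esub> y I = I +> c \<and> x J \<otimes>\<^bsub>R Quot J\<^esub> y J = J +> c"
      unfolding a b using a(1) b(1) fin_ideals_ideal[OF I] fin_ideals_ideal[OF J]
      by (intro bexI[of _ "a \<otimes> b"] conjI Quot_coset_simps) auto
  qed
  show "\<one>\<^bsub>ring_completion R\<^esub> \<in> carrier (ring_completion R)"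
    unfolding ring_completion_simps(2)
    by (rule ring_completionI, rule bexI[of _ \<one>])
      (simp_all add: Quot_coset_simps(3)[OF fin_ideals_ideal one_closed one_closed])
  show "\<zero>\<^bsub>ring_completion R\<^esub> \<in> carrier (ring_completion R)"
    unfolding ring_completion_simps(3)
    by (rule ring_completionI, rule bexI[of _ \<zero>])
      (simp_all add: Quot_coset_simps(4)[OF fin_ideals_ideal one_closed one_closed])
qed

lemma ring_completion_mem_Quot:
  assumes "x \<in> carrier (ring_completion R)" "I \<in> fin_ideals R"
  shows "x I \<in> carrier (R Quot I)"
  using lim_carrierD(2)[of x R "fin_ideals R" I] assms by (simp add: FactRing_def)

end

lemma (in cring) ring_completion_cring: "cring (ring_completion R)"
proof -
  let ?C = "ring_completion R"
  note closed = ring_completion_closed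
  note mem = ring_completion_mem_Quot
  have Q: "cring (R Quot I)" if "I \<in> fin_ideals R" for I
    by (rule ideal.quotient_is_cring[OF fin_ideals_ideal[OF that] is_cring])
  have Qr: "ring (R Quot I)" if "I \<in> fin_ideals R" for I
    by (rule cring.axioms(1)[OF Q[OF that]])
  have Qa: "abelian_group (R Quot I)" if "I \<in> fin_ideals R" for I
    by (rule ring.is_abelian_group[OF Qr[OF that]])
  have Qm: "abelian_monoid (R Quot I)" if "I \<in> fin_ideals R" for I
    by (rule abelian_group.axioms(1)[OF Qa[OF that]])
  have Qc: "Group.comm_monoid (R Quot I)" if "I \<in> fin_ideals R" for I
    by (rule cring.axioms(2)[OF Q[OF that]])
  have app: "(x \<oplus>\<^bsub>?C\<^esub> y) I = x I \<oplus>\<^bsub>R Quot I\<^esub> y I" "(x \<otimes>\<^bsub>?C\<^esub> y) I = x I \<otimes>\<^bsub>R Quot I\<^esub> y I"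
    "\<one>\<^bsub>?C\<^esub> I = \<one>\<^bsub>R Quot I\<^esub>" "\<zero>\<^bsub>?C\<^esub> I = \<zero>\<^bsub>R Quot I\<^esub>"
    if "I \<in> fin_ideals R" for x y I
    using that by simp_all
  show ?thesis
  proof (rule cringI)
    show "abelian_group ?C"
    proof (rule abelian_groupI)
      fix x y z assume x: "x \<in> carrier ?C" and y: "y \<in> carrier ?C" and z: "z \<in> carrier ?C"
      show "(x \<oplus>\<^bsub>?C\<^esub> y) \<oplus>\<^bsub>?C\<^esub> z = x \<oplus>\<^bsub>?C\<^esub> (y \<oplus>\<^bsub>?C\<^esub> z)"
      proof (rule ring_completion_eqI)
        show "((x \<oplus>\<^bsub>?C\<^esub> y) \<oplus>\<^bsub>?C\<^esub> z) I = (x \<oplus>\<^bsub>?C\<^esub> (y \<oplus>\<^bsub>?C\<^esub> z)) I" if I: "I \<in> fin_ideals R" for I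
          unfolding app[OF I] by (rule abelian_monoid.a_assoc[OF Qm[OF I] mem[OF x I] mem[OF y I] mem[OF z I]])
      qed (intro closed x y z)+
    next
      fix x y assume x: "x \<in> carrier ?C" and y: "y \<in> carrier ?C"
      show "x \<oplus>\<^bsub>?C\<^esub> y = y \<oplus>\<^bsub>?C\<^esub> x"
      proof (rule ring_completion_eqI)
        show "(x \<oplus>\<^bsub>?C\<^esub> y) I = (y \<oplus>\<^bsub>?C\<^esub> x) I" if I: "I \<in> fin_ideals R" for I
          unfolding app[OF I] by (rule abelian_monoid.a_comm[OF Qm[OF I] mem[OF x I] mem[OF y I]])
      qed (intro closed x y)+
      show "x \<oplus>\<^bsub>?C\<^esub> y \<in> carrier ?C" by (intro closed x y)
    next
      have e: "to_ring_completion R \<one> \<in> carrier ?C"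
        by (rule to_ring_completion_closed[OF one_closed])
      show "\<zero>\<^bsub>?C\<^esub> \<in> carrier ?C" by (rule closed(4)[OF e e])
    next
      fix x assume x: "x \<in> carrier ?C"
      show "\<zero>\<^bsub>?C\<^esub> \<oplus>\<^bsub>?C\<^esub> x = x"
      proof (rule ring_completion_eqI)
        show "(\<zero>\<^bsub>?C\<^esub> \<oplus>\<^bsub>?C\<^esub> x) I = x I" if I: "I \<in> fin_ideals R" for I
          unfolding app[OF I] by (rule abelian_monoid.l_zero[OF Qm[OF I] mem[OF x I]])
        show "\<zero>\<^bsub>?C\<^esub> \<oplus>\<^bsub>?C\<^esub> x \<in> carrier ?C" by (intro closed(1) closed(4)[OF x x] x)
      qed (rule x)
      define y where "y = (\<lambda>I\<in>fin_ideals R. \<ominus>\<^bsub>R Quot I\<^esub> x I)"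
      have y: "y \<in> carrier ?C"
        unfolding y_def
      proof (rule ring_completionI)
        fix I J assume I: "I \<in> fin_ideals R" and J: "J \<in> fin_ideals R" and IJ: "I \<subseteq> J"
        obtain a where a: "a \<in> carrier R" "x I = I +> a" "x J = J +> a"
          by (rule ring_completion_coset2[OF x I J IJ])
        have minus: "\<ominus>\<^bsub>R Quot K\<^esub> (K +> a) = K +> (\<ominus> a)" if K: "K \<in> fin_ideals R" for K
        proof -
          interpret h: ring_hom_ring R "R Quot K" "(+>) K"
            by (rule ideal.rcos_ring_hom_ring[OF fin_ideals_ideal[OF K]])
          show ?thesis using h.hom_a_inv[OF a(1)] by simp
        qed
        show "\<exists>c\<in>carrier R. \<ominus>\<^bsub>R Quot I\<^esub> x I = I +> c \<and> \<ominus>\<^bsub>R Quot J\<^esub> x J = J +> c"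
          unfolding a minus[OF I] minus[OF J] using a(1) by (intro bexI[of _ "\<ominus> a"]) auto
      qed
      have "y \<oplus>\<^bsub>?C\<^esub> x = \<zero>\<^bsub>?C\<^esub>"
      proof (rule ring_completion_eqI)
        show "(y \<oplus>\<^bsub>?C\<^esub> x) I = \<zero>\<^bsub>?C\<^esub> I" if I: "I \<in> fin_ideals R" for I
          unfolding app[OF I] using abelian_group.l_neg[OF Qa[OF I] mem[OF x I]] I
          by (simp add: y_def)
      qed (intro closed(1) closed(4)[OF x x] x y)+
      then show "\<exists>y\<in>carrier ?C. y \<oplus>\<^bsub>?C\<^esub> x = \<zero>\<^bsub>?C\<^esub>"
        using y by (rule bexI)
    qed
  next
    show "Group.comm_monoid ?C"
    proof (rule comm_monoidI)
      fix x y z assume x: "x \<in> carrier ?C" and y: "y \<in> carrier ?C" and z: "z \<in> carrier ?C"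
      show "(x \<otimes>\<^bsub>?C\<^esub> y) \<otimes>\<^bsub>?C\<^esub> z = x \<otimes>\<^bsub>?C\<^esub> (y \<otimes>\<^bsub>?C\<^esub> z)"
      proof (rule ring_completion_eqI)
        show "((x \<otimes>\<^bsub>?C\<^esub> y) \<otimes>\<^bsub>?C\<^esub> z) I = (x \<otimes>\<^bsub>?C\<^esub> (y \<otimes>\<^bsub>?C\<^esub> z)) I" if I: "I \<in> fin_ideals R" for I
          unfolding app[OF I]
          by (rule monoid.m_assoc[OF comm_monoid.axioms(1)[OF Qc[OF I]] mem[OF x I] mem[OF y I] mem[OF z I]])
      qed (intro closed(2) x y z)+
    next
      fix x y assume x: "x \<in> carrier ?C" and y: "y \<in> carrier ?C"
      show "x \<otimes>\<^bsub>?C\<^esub> y = y \<otimes>\<^bsub>?C\<^esub> x"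
      proof (rule ring_completion_eqI)
        show "(x \<otimes>\<^bsub>?C\<^esub> y) I = (y \<otimes>\<^bsub>?C\<^esub> x) I" if I: "I \<in> fin_ideals R" for I
          unfolding app[OF I] by (rule comm_monoid.m_comm[OF Qc[OF I] mem[OF x I] mem[OF y I]])
      qed (intro closed(2) x y)+
      show "x \<otimes>\<^bsub>?C\<^esub> y \<in> carrier ?C" by (intro closed(2) x y)
    next
      have e: "to_ring_completion R \<one> \<in> carrier ?C"
        by (rule to_ring_completion_closed[OF one_closed])
      show "\<one>\<^bsub>?C\<^esub> \<in> carrier ?C" by (rule closed(3)[OF e e])
      fix x assume x: "x \<in> carrier ?C"
      show "\<one>\<^bsub>?C\<^esub> \<otimes>\<^bsub>?C\<^esub> x = x"
      proof (rule ring_completion_eqI)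
        show "(\<one>\<^bsub>?C\<^esub> \<otimes>\<^bsub>?C\<^esub> x) I = x I" if I: "I \<in> fin_ideals R" for I
          unfolding app[OF I]
          by (rule monoid.l_one[OF comm_monoid.axioms(1)[OF Qc[OF I]] mem[OF x I]])
        show "\<one>\<^bsub>?C\<^esub> \<otimes>\<^bsub>?C\<^esub> x \<in> carrier ?C" by (intro closed(2) closed(3)[OF x x] x)
      qed (rule x)
    qed
  next
    fix x y z assume x: "x \<in> carrier ?C" and y: "y \<in> carrier ?C" and z: "z \<in> carrier ?C"
    show "(x \<oplus>\<^bsub>?C\<^esub> y) \<otimes>\<^bsub>?C\<^esub> z = x \<otimes>\<^bsub>?C\<^esub> z \<oplus>\<^bsub>?C\<^esub> y \<otimes>\<^bsub>?C\<^esub> z"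
    proof (rule ring_completion_eqI)
      fix I assume I: "I \<in> fin_ideals R"
      interpret Q: ring "R Quot I" by (rule Qr[OF I])
      show "((x \<oplus>\<^bsub>?C\<^esub> y) \<otimes>\<^bsub>?C\<^esub> z) I = (x \<otimes>\<^bsub>?C\<^esub> z \<oplus>\<^bsub>?C\<^esub> y \<otimes>\<^bsub>?C\<^esub> z) I"
        unfolding app[OF I] by (rule Q.l_distr[OF mem[OF x I] mem[OF y I] mem[OF z I]])
    qed (intro closed(1,2) x y z)+
  qed
qed


subsection \<open>The completed module\<close>

lemma fin_submodules_submodule: "N \<in> fin_submodules R M \<Longrightarrow> submodule N R M"
  by (simp add: fin_submodules_def)

lemma fin_submodules_subgroup: "N \<in> fin_submodules R M \<Longrightarrow> additive_subgroup N M"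
  by (rule submodule_additive_subgroup[OF fin_submodules_submodule])

lemma module_completion_simps [simp]:
  "carrier (module_completion R M) = lim_carrier M (fin_submodules R M)"
  "\<zero>\<^bsub>module_completion R M\<^esub> = (\<lambda>N\<in>fin_submodules R M. \<zero>\<^bsub>FactModule M N\<^esub>)"
  "u \<oplus>\<^bsub>module_completion R M\<^esub> v = (\<lambda>N\<in>fin_submodules R M. u N \<oplus>\<^bsub>FactModule M N\<^esub> v N)"
  "x \<odot>\<^bsub>module_completion R M\<^esub> u = (\<lambda>N\<in>fin_submodules R M.
       \<Union>r\<in>x (annihilator R (FactModule M N)). r \<odot>\<^bsub>FactModule M N\<^esub> u N)"
  by (simp_all add: module_completion_def)

context Module.module
begin

lemma FactModule_coset_simps:
  assumes "submodule N R M" "a \<in> carrier M" "b \<in> carrier M"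
  shows "(N +>\<^bsub>M\<^esub> a) \<oplus>\<^bsub>FactModule M N\<^esub> (N +>\<^bsub>M\<^esub> b) = N +>\<^bsub>M\<^esub> (a \<oplus>\<^bsub>M\<^esub> b)"
    and "\<zero>\<^bsub>FactModule M N\<^esub> = N +>\<^bsub>M\<^esub> \<zero>\<^bsub>M\<^esub>"
    and "\<ominus>\<^bsub>FactModule M N\<^esub> (N +>\<^bsub>M\<^esub> a) = N +>\<^bsub>M\<^esub> (\<ominus>\<^bsub>M\<^esub> a)"
proof -
  interpret N: abelian_subgroup N M
    by (rule submodule_abelian_subgroup[OF assms(1)])
  interpret Q: Module.module R "FactModule M N"
    by (rule FactModule_is_module[OF assms(1)])
  show sum: "(N +>\<^bsub>M\<^esub> a) \<oplus>\<^bsub>FactModule M N\<^esub> (N +>\<^bsub>M\<^esub> b) = N +>\<^bsub>M\<^esub> (a \<oplus>\<^bsub>M\<^esub> b)"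
    using assms(2,3) by (simp add: N.a_rcos_sum)
  show zero: "\<zero>\<^bsub>FactModule M N\<^esub> = N +>\<^bsub>M\<^esub> \<zero>\<^bsub>M\<^esub>"
    using M.a_coset_add_zero[OF N.a_subset] by simp
  have mem: "N +>\<^bsub>M\<^esub> c \<in> carrier (FactModule M N)" if "c \<in> carrier M" for c
    using M.a_rcosetsI[OF N.a_subset that] by simp
  have "(N +>\<^bsub>M\<^esub> (\<ominus>\<^bsub>M\<^esub> a)) \<oplus>\<^bsub>FactModule M N\<^esub> (N +>\<^bsub>M\<^esub> a) = \<zero>\<^bsub>FactModule M N\<^esub>"
    unfolding zero using assms(2) by (simp add: N.a_rcos_sum M.l_neg)
  then show "\<ominus>\<^bsub>FactModule M N\<^esub> (N +>\<^bsub>M\<^esub> a) = N +>\<^bsub>M\<^esub> (\<ominus>\<^bsub>M\<^esub> a)"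
    by (rule Q.M.minus_equality) (intro mem M.a_inv_closed assms(2))+
qed

lemma module_completion_coset:
  assumes "u \<in> carrier (module_completion R M)" "N \<in> fin_submodules R M"
  obtains a where "a \<in> carrier M" "u N = N +>\<^bsub>M\<^esub> a"
  by (rule M.lim_carrier_coset[OF fin_submodules_subgroup assms(1)[unfolded module_completion_simps]
        assms(2)]) (assumption, rule that)

lemma module_completion_coset2:
  assumes "u \<in> carrier (module_completion R M)"
    and "N \<in> fin_submodules R M" "N' \<in> fin_submodules R M" "N \<subseteq> N'"
  obtains a where "a \<in> carrier M" "u N = N +>\<^bsub>M\<^esub> a" "u N' = N' +>\<^bsub>M\<^esub> a"
  by (rule M.lim_carrierE[OF fin_submodules_subgroup assms(1)[unfolded module_completion_simps]
        assms(2-4)]) (assumption, rule that)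

lemma module_completionI:
  assumes "\<And>N N'. \<lbrakk>N \<in> fin_submodules R M; N' \<in> fin_submodules R M; N \<subseteq> N'\<rbrakk> \<Longrightarrow>
      \<exists>a\<in>carrier M. \<phi> N = N +>\<^bsub>M\<^esub> a \<and> \<phi> N' = N' +>\<^bsub>M\<^esub> a"
  shows "restrict \<phi> (fin_submodules R M) \<in> carrier (module_completion R M)"
  unfolding module_completion_simps by (rule M.lim_carrierI[OF fin_submodules_subgroup assms])

lemma module_completion_eqI:
  assumes "u \<in> carrier (module_completion R M)" "v \<in> carrier (module_completion R M)"
    and "\<And>N. N \<in> fin_submodules R M \<Longrightarrow> u N = v N"
  shows "u = v"
  using assms unfolding module_completion_simps by (rule M.lim_carrier_eqI)

lemma module_completion_mem:
  assumes "u \<in> carrier (module_completion R M)" "N \<in> fin_submodules R M"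
  shows "u N \<in> carrier (FactModule M N)"
  using lim_carrierD(2)[of u M "fin_submodules R M" N] assms by simp

lemma module_completion_smult_apply:
  assumes "N \<in> fin_submodules R M" "u \<in> carrier (module_completion R M)" "r \<in> carrier R"
    and "x (annihilator R (FactModule M N)) = annihilator R (FactModule M N) +>\<^bsub>R\<^esub> r"
  shows "(x \<odot>\<^bsub>module_completion R M\<^esub> u) N = r \<odot>\<^bsub>FactModule M N\<^esub> u N"
proof -
  let ?I = "annihilator R (FactModule M N)"
  interpret Q: Module.module R "FactModule M N"
    by (rule FactModule_is_module[OF fin_submodules_submodule[OF assms(1)]])
  interpret I: ideal ?I R
    by (rule Q.annihilator_ideal)
  have "s \<odot>\<^bsub>FactModule M N\<^esub> u N = r \<odot>\<^bsub>FactModule M N\<^esub> u N" if "s \<in> ?I +>\<^bsub>R\<^esub> r" for s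
    by (rule Q.annihilator_coset_smult[OF assms(3) that module_completion_mem[OF assms(2,1)]])
  moreover have "r \<in> ?I +>\<^bsub>R\<^esub> r"
    by (rule I.a_rcos_self[OF assms(3)])
  ultimately have "(\<Union>s\<in>?I +>\<^bsub>R\<^esub> r. s \<odot>\<^bsub>FactModule M N\<^esub> u N) = r \<odot>\<^bsub>FactModule M N\<^esub> u N"
    by blast
  moreover have "(x \<odot>\<^bsub>module_completion R M\<^esub> u) N = (\<Union>s\<in>?I +>\<^bsub>R\<^esub> r. s \<odot>\<^bsub>FactModule M N\<^esub> u N)"
    unfolding module_completion_simps(4) restrict_apply'[OF assms(1)] assms(4) ..
  ultimately show ?thesis
    by (rule trans[rotated])
qed

lemma annihilator_FactModule_mono:
  assumes "submodule N R M" "submodule N' R M" "N \<subseteq> N'"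
  shows "annihilator R (FactModule M N) \<subseteq> annihilator R (FactModule M N')"
proof
  fix r assume r: "r \<in> annihilator R (FactModule M N)"
  have rR: "r \<in> carrier R"
    using r by (simp add: annihilator_def)
  interpret N: abelian_subgroup N M
    by (rule submodule_abelian_subgroup[OF assms(1)])
  interpret N': abelian_subgroup N' M
    by (rule submodule_abelian_subgroup[OF assms(2)])
  have "r \<odot>\<^bsub>FactModule M N'\<^esub> (N' +>\<^bsub>M\<^esub> a) = \<zero>\<^bsub>FactModule M N'\<^esub>" if a: "a \<in> carrier M" for a
  proof -
    have "r \<odot>\<^bsub>FactModule M N\<^esub> (N +>\<^bsub>M\<^esub> a) = \<zero>\<^bsub>FactModule M N\<^esub>"
      using r M.a_rcosetsI[OF N.a_subset a] unfolding annihilator_def by simp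
    then have "N +>\<^bsub>M\<^esub> (r \<odot>\<^bsub>M\<^esub> a) = N"
      unfolding FactModule_smult[OF assms(1) rR a] by simp
    then have "r \<odot>\<^bsub>M\<^esub> a \<in> N'"
      using N.a_rcos_self[of "r \<odot>\<^bsub>M\<^esub> a"] rR a assms(3) by auto
    then show ?thesis
      unfolding FactModule_smult[OF assms(2) rR a] by (simp add: N'.a_rcos_const)
  qed
  then show "r \<in> annihilator R (FactModule M N')"
    unfolding annihilator_def using rR by (auto simp: a_rcosets_iff simp del: FactModule_simps(4))
qed

lemma module_completion_closed:
  assumes u: "u \<in> carrier (module_completion R M)" and v: "v \<in> carrier (module_completion R M)"
    and x: "x \<in> carrier (ring_completion R)"
  shows "u \<oplus>\<^bsub>module_completion R M\<^esub> v \<in> carrier (module_completion R M)"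
    and "\<zero>\<^bsub>module_completion R M\<^esub> \<in> carrier (module_completion R M)"
    and "x \<odot>\<^bsub>module_completion R M\<^esub> u \<in> carrier (module_completion R M)"
proof -
  let ?S = "fin_submodules R M"
  note sub = fin_submodules_submodule
  show "u \<oplus>\<^bsub>module_completion R M\<^esub> v \<in> carrier (module_completion R M)"
    unfolding module_completion_simps(3)
  proof (rule module_completionI)
    fix N N' assume N: "N \<in> ?S" and N': "N' \<in> ?S" and NN': "N \<subseteq> N'"
    obtain a where a: "a \<in> carrier M" "u N = N +>\<^bsub>M\<^esub> a" "u N' = N' +>\<^bsub>M\<^esub> a"
      by (rule module_completion_coset2[OF u N N' NN'])
    obtain b where b: "b \<in> carrier M" "v N = N +>\<^bsub>M\<^esub> b" "v N' = N' +>\<^bsub>M\<^esub> b"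
      by (rule module_completion_coset2[OF v N N' NN'])
    show "\<exists>c\<in>carrier M. u N \<oplus>\<^bsub>FactModule M N\<^esub> v N = N +>\<^bsub>M\<^esub> c \<and>
        u N' \<oplus>\<^bsub>FactModule M N'\<^esub> v N' = N' +>\<^bsub>M\<^esub> c"
      unfolding a b using FactModule_coset_simps(1)[OF sub[OF N] a(1) b(1)]
        FactModule_coset_simps(1)[OF sub[OF N'] a(1) b(1)] M.a_closed[OF a(1) b(1)] by blast
  qed
  show "\<zero>\<^bsub>module_completion R M\<^esub> \<in> carrier (module_completion R M)"
    unfolding module_completion_simps(2)
  proof (rule module_completionI)
    fix N N' assume N: "N \<in> ?S" and N': "N' \<in> ?S" and NN': "N \<subseteq> N'"
    show "\<exists>c\<in>carrier M. \<zero>\<^bsub>FactModule M N\<^esub> = N +>\<^bsub>M\<^esub> c \<and> \<zero>\<^bsub>FactModule M N'\<^esub> = N' +>\<^bsub>M\<^esub> c"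
      using FactModule_coset_simps(2)[OF sub[OF N] M.zero_closed M.zero_closed]
        FactModule_coset_simps(2)[OF sub[OF N'] M.zero_closed M.zero_closed] M.zero_closed by blast
  qed
  have "(\<lambda>N\<in>?S. (x \<odot>\<^bsub>module_completion R M\<^esub> u) N) \<in> carrier (module_completion R M)"
  proof (rule module_completionI)
    fix N N' assume N: "N \<in> ?S" and N': "N' \<in> ?S" and NN': "N \<subseteq> N'"
    obtain a where a: "a \<in> carrier M" "u N = N +>\<^bsub>M\<^esub> a" "u N' = N' +>\<^bsub>M\<^esub> a"
      by (rule module_completion_coset2[OF u N N' NN'])
    obtain r where r: "r \<in> carrier R"
        "x (annihilator R (FactModule M N)) = annihilator R (FactModule M N) +>\<^bsub>R\<^esub> r"
        "x (annihilator R (FactModule M N')) = annihilator R (FactModule M N') +>\<^bsub>R\<^esub> r"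
      by (rule R.ring_completion_coset2[OF x fin_submodules_annihilator[OF N]
            fin_submodules_annihilator[OF N'] annihilator_FactModule_mono[OF sub[OF N] sub[OF N'] NN']])
    show "\<exists>c\<in>carrier M. (x \<odot>\<^bsub>module_completion R M\<^esub> u) N = N +>\<^bsub>M\<^esub> c \<and>
        (x \<odot>\<^bsub>module_completion R M\<^esub> u) N' = N' +>\<^bsub>M\<^esub> c"
      unfolding module_completion_smult_apply[of N u r x, OF N u r(1,2)]
        module_completion_smult_apply[of N' u r x, OF N' u r(1,3)] a
        FactModule_smult[OF sub[OF N] r(1) a(1)] FactModule_smult[OF sub[OF N'] r(1) a(1)]
      using smult_closed[OF r(1) a(1)] by blast
  qed
  then show "x \<odot>\<^bsub>module_completion R M\<^esub> u \<in> carrier (module_completion R M)"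
    by (simp only: module_completion_simps(4) restrict_restrict Int_absorb)
qed

lemma module_completion_module: "Module.module (ring_completion R) (module_completion R M)"
proof -
  let ?R = "ring_completion R" and ?C = "module_completion R M" and ?S = "fin_submodules R M"
  let ?I = "\<lambda>N. annihilator R (FactModule M N)"
  note sub = fin_submodules_submodule
  note mem = module_completion_mem
  note ann = fin_submodules_annihilator
  note zero_mem = R.to_ring_completion_closed[OF R.zero_closed]
  note closed = module_completion_closed(1)[OF _ _ zero_mem]
  note smult_cl = module_completion_closed(3)
  have Q: "Module.module R (FactModule M N)" if "N \<in> ?S" for N
    by (rule FactModule_is_module[OF sub[OF that]])
  have Qa: "abelian_group (FactModule M N)" if "N \<in> ?S" for N
    by (rule module.axioms(2)[OF Q[OF that]])
  have Qm: "abelian_monoid (FactModule M N)" if "N \<in> ?S" for N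
    by (rule abelian_group.axioms(1)[OF Qa[OF that]])
  have app: "(u \<oplus>\<^bsub>?C\<^esub> v) N = u N \<oplus>\<^bsub>FactModule M N\<^esub> v N" "\<zero>\<^bsub>?C\<^esub> N = \<zero>\<^bsub>FactModule M N\<^esub>"
    if "N \<in> ?S" for u v N
    using that unfolding module_completion_simps by simp_all
  have z: "\<zero>\<^bsub>?C\<^esub> \<in> carrier ?C"
  proof -
    have "to_lim M ?S \<zero>\<^bsub>M\<^esub> \<in> carrier ?C"
      unfolding module_completion_simps
      by (rule M.to_lim_closed[OF fin_submodules_subgroup M.zero_closed])
    then show ?thesis
      by (intro module_completion_closed(2)[OF _ _ zero_mem])
  qed
  show ?thesis
  proof (rule moduleI)
    show "cring ?R" by (rule R.ring_completion_cring)
    show "abelian_group ?C"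
    proof (rule abelian_groupI)
      show "\<zero>\<^bsub>?C\<^esub> \<in> carrier ?C" by (rule z)
      fix u v w assume u: "u \<in> carrier ?C" and v: "v \<in> carrier ?C" and w: "w \<in> carrier ?C"
      show "(u \<oplus>\<^bsub>?C\<^esub> v) \<oplus>\<^bsub>?C\<^esub> w = u \<oplus>\<^bsub>?C\<^esub> (v \<oplus>\<^bsub>?C\<^esub> w)"
      proof (rule module_completion_eqI)
        show "((u \<oplus>\<^bsub>?C\<^esub> v) \<oplus>\<^bsub>?C\<^esub> w) N = (u \<oplus>\<^bsub>?C\<^esub> (v \<oplus>\<^bsub>?C\<^esub> w)) N" if N: "N \<in> ?S" for N
          unfolding app[OF N] by (rule abelian_monoid.a_assoc[OF Qm[OF N] mem[OF u N] mem[OF v N] mem[OF w N]])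
      qed (intro closed u v w)+
    next
      fix u v assume u: "u \<in> carrier ?C" and v: "v \<in> carrier ?C"
      show "u \<oplus>\<^bsub>?C\<^esub> v \<in> carrier ?C" by (rule closed[OF u v])
      show "u \<oplus>\<^bsub>?C\<^esub> v = v \<oplus>\<^bsub>?C\<^esub> u"
      proof (rule module_completion_eqI)
        show "(u \<oplus>\<^bsub>?C\<^esub> v) N = (v \<oplus>\<^bsub>?C\<^esub> u) N" if N: "N \<in> ?S" for N
          unfolding app[OF N] by (rule abelian_monoid.a_comm[OF Qm[OF N] mem[OF u N] mem[OF v N]])
      qed (intro closed u v)+
    next
      fix u assume u: "u \<in> carrier ?C"
      show "\<zero>\<^bsub>?C\<^esub> \<oplus>\<^bsub>?C\<^esub> u = u"
      proof (rule module_completion_eqI)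
        show "(\<zero>\<^bsub>?C\<^esub> \<oplus>\<^bsub>?C\<^esub> u) N = u N" if N: "N \<in> ?S" for N
          unfolding app[OF N] by (rule abelian_monoid.l_zero[OF Qm[OF N] mem[OF u N]])
      qed (intro closed u z)+
      define v where "v = (\<lambda>N\<in>?S. \<ominus>\<^bsub>FactModule M N\<^esub> u N)"
      have v: "v \<in> carrier ?C"
        unfolding v_def
      proof (rule module_completionI)
        fix N N' assume N: "N \<in> ?S" and N': "N' \<in> ?S" and NN': "N \<subseteq> N'"
        obtain a where a: "a \<in> carrier M" "u N = N +>\<^bsub>M\<^esub> a" "u N' = N' +>\<^bsub>M\<^esub> a"
          by (rule module_completion_coset2[OF u N N' NN'])
        show "\<exists>c\<in>carrier M. \<ominus>\<^bsub>FactModule M N\<^esub> u N = N +>\<^bsub>M\<^esub> c \<and>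
            \<ominus>\<^bsub>FactModule M N'\<^esub> u N' = N' +>\<^bsub>M\<^esub> c"
          unfolding a FactModule_coset_simps(3)[OF sub[OF N] a(1) a(1)]
            FactModule_coset_simps(3)[OF sub[OF N'] a(1) a(1)]
          using M.a_inv_closed[OF a(1)] by blast
      qed
      have "v \<oplus>\<^bsub>?C\<^esub> u = \<zero>\<^bsub>?C\<^esub>"
      proof (rule module_completion_eqI)
        show "(v \<oplus>\<^bsub>?C\<^esub> u) N = \<zero>\<^bsub>?C\<^esub> N" if N: "N \<in> ?S" for N
          unfolding app[OF N] v_def restrict_apply'[OF N]
          by (rule abelian_group.l_neg[OF Qa[OF N] mem[OF u N]])
      qed (intro closed u v z)+
      then show "\<exists>v\<in>carrier ?C. v \<oplus>\<^bsub>?C\<^esub> u = \<zero>\<^bsub>?C\<^esub>"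
        using v by (rule bexI)
    qed
  next
    fix x y u assume x: "x \<in> carrier ?R" and y: "y \<in> carrier ?R" and u: "u \<in> carrier ?C"
    show "(x \<oplus>\<^bsub>?R\<^esub> y) \<odot>\<^bsub>?C\<^esub> u = x \<odot>\<^bsub>?C\<^esub> u \<oplus>\<^bsub>?C\<^esub> y \<odot>\<^bsub>?C\<^esub> u"
    proof (rule module_completion_eqI)
      fix N assume N: "N \<in> ?S"
      interpret Q: Module.module R "FactModule M N" by (rule Q[OF N])
      obtain r where r: "r \<in> carrier R" "x (?I N) = ?I N +>\<^bsub>R\<^esub> r"
        by (rule R.ring_completion_coset[OF x ann[OF N]])
      obtain s where s: "s \<in> carrier R" "y (?I N) = ?I N +>\<^bsub>R\<^esub> s"
        by (rule R.ring_completion_coset[OF y ann[OF N]])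
      have "(x \<oplus>\<^bsub>?R\<^esub> y) (?I N) = ?I N +>\<^bsub>R\<^esub> (r \<oplus>\<^bsub>R\<^esub> s)"
        unfolding ring_completion_simps(5) restrict_apply'[OF ann[OF N]] r(2) s(2)
        by (rule R.Quot_coset_simps(1)[OF fin_ideals_ideal[OF ann[OF N]] r(1) s(1)])
      note xy = module_completion_smult_apply[of N u "r \<oplus>\<^bsub>R\<^esub> s" "x \<oplus>\<^bsub>?R\<^esub> y", OF N u R.a_closed[OF r(1) s(1)] this]
      show "((x \<oplus>\<^bsub>?R\<^esub> y) \<odot>\<^bsub>?C\<^esub> u) N = (x \<odot>\<^bsub>?C\<^esub> u \<oplus>\<^bsub>?C\<^esub> y \<odot>\<^bsub>?C\<^esub> u) N"
        unfolding xy app[OF N] module_completion_smult_apply[of N u r x, OF N u r]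
          module_completion_smult_apply[of N u s y, OF N u s]
        by (rule Q.smult_l_distr[OF r(1) s(1) mem[OF u N]])
    qed (intro closed smult_cl[OF u u] R.ring_completion_closed(1) x y)+
    show "(x \<otimes>\<^bsub>?R\<^esub> y) \<odot>\<^bsub>?C\<^esub> u = x \<odot>\<^bsub>?C\<^esub> (y \<odot>\<^bsub>?C\<^esub> u)"
    proof (rule module_completion_eqI)
      fix N assume N: "N \<in> ?S"
      interpret Q: Module.module R "FactModule M N" by (rule Q[OF N])
      obtain r where r: "r \<in> carrier R" "x (?I N) = ?I N +>\<^bsub>R\<^esub> r"
        by (rule R.ring_completion_coset[OF x ann[OF N]])
      obtain s where s: "s \<in> carrier R" "y (?I N) = ?I N +>\<^bsub>R\<^esub> s"
        by (rule R.ring_completion_coset[OF y ann[OF N]])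
      have "(x \<otimes>\<^bsub>?R\<^esub> y) (?I N) = ?I N +>\<^bsub>R\<^esub> (r \<otimes>\<^bsub>R\<^esub> s)"
        unfolding ring_completion_simps(4) restrict_apply'[OF ann[OF N]] r(2) s(2)
        by (rule R.Quot_coset_simps(2)[OF fin_ideals_ideal[OF ann[OF N]] r(1) s(1)])
      note xy = module_completion_smult_apply[of N u "r \<otimes>\<^bsub>R\<^esub> s" "x \<otimes>\<^bsub>?R\<^esub> y", OF N u R.m_closed[OF r(1) s(1)] this]
      show "((x \<otimes>\<^bsub>?R\<^esub> y) \<odot>\<^bsub>?C\<^esub> u) N = (x \<odot>\<^bsub>?C\<^esub> (y \<odot>\<^bsub>?C\<^esub> u)) N"
        unfolding xy module_completion_smult_apply[of N "y \<odot>\<^bsub>?C\<^esub> u" r x, OF N smult_cl[OF u u y] r]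
          module_completion_smult_apply[of N u s y, OF N u s]
        by (rule Q.smult_assoc1[OF r(1) s(1) mem[OF u N]])
    qed (rule smult_cl[OF u u R.ring_completion_closed(2)[OF x y]],
        rule smult_cl[OF smult_cl[OF u u y] u x])
    show "x \<odot>\<^bsub>?C\<^esub> u \<in> carrier ?C" by (rule smult_cl[OF u u x])
  next
    fix x u v assume x: "x \<in> carrier ?R" and u: "u \<in> carrier ?C" and v: "v \<in> carrier ?C"
    show "x \<odot>\<^bsub>?C\<^esub> (u \<oplus>\<^bsub>?C\<^esub> v) = x \<odot>\<^bsub>?C\<^esub> u \<oplus>\<^bsub>?C\<^esub> x \<odot>\<^bsub>?C\<^esub> v"
    proof (rule module_completion_eqI)
      fix N assume N: "N \<in> ?S"
      interpret Q: Module.module R "FactModule M N" by (rule Q[OF N])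
      obtain r where r: "r \<in> carrier R" "x (?I N) = ?I N +>\<^bsub>R\<^esub> r"
        by (rule R.ring_completion_coset[OF x ann[OF N]])
      show "(x \<odot>\<^bsub>?C\<^esub> (u \<oplus>\<^bsub>?C\<^esub> v)) N = (x \<odot>\<^bsub>?C\<^esub> u \<oplus>\<^bsub>?C\<^esub> x \<odot>\<^bsub>?C\<^esub> v) N"
        unfolding app[OF N] module_completion_smult_apply[of N u r x, OF N u r]
          module_completion_smult_apply[of N v r x, OF N v r] module_completion_smult_apply[of N "u \<oplus>\<^bsub>?C\<^esub> v" r x, OF N closed[OF u v] r]
        by (rule Q.smult_r_distr[OF r(1) mem[OF u N] mem[OF v N]])
    qed (rule smult_cl[OF closed[OF u v] u x], rule closed[OF smult_cl[OF u u x] smult_cl[OF v v x]])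
  next
    fix u assume u: "u \<in> carrier ?C"
    have one: "\<one>\<^bsub>?R\<^esub> \<in> carrier ?R"
      by (rule R.ring_completion_closed(3)[OF zero_mem zero_mem])
    show "\<one>\<^bsub>?R\<^esub> \<odot>\<^bsub>?C\<^esub> u = u"
    proof (rule module_completion_eqI)
      fix N assume N: "N \<in> ?S"
      interpret Q: Module.module R "FactModule M N" by (rule Q[OF N])
      have "\<one>\<^bsub>?R\<^esub> (?I N) = ?I N +>\<^bsub>R\<^esub> \<one>\<^bsub>R\<^esub>"
        unfolding ring_completion_simps(2) restrict_apply'[OF ann[OF N]]
        by (rule R.Quot_coset_simps(3)[OF fin_ideals_ideal[OF ann[OF N]] R.one_closed R.one_closed])
      then show "(\<one>\<^bsub>?R\<^esub> \<odot>\<^bsub>?C\<^esub> u) N = u N"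
        unfolding module_completion_smult_apply[of N u "\<one>\<^bsub>R\<^esub>" "\<one>\<^bsub>?R\<^esub>", OF N u R.one_closed \<open>\<one>\<^bsub>?R\<^esub> (?I N) = _\<close>]
        by (intro Q.smult_one mem[OF u N])
    qed (rule smult_cl[OF u u one], rule u)
  qed
qed

lemma smult_to_ring_completion:
  assumes "r \<in> carrier R" "u \<in> carrier (module_completion R M)"
  shows "to_ring_completion R r \<odot>\<^bsub>module_completion R M\<^esub> u =
    (\<lambda>N\<in>fin_submodules R M. r \<odot>\<^bsub>FactModule M N\<^esub> u N)"
proof (rule extensionalityI)
  fix N assume N: "N \<in> fin_submodules R M"
  show "(to_ring_completion R r \<odot>\<^bsub>module_completion R M\<^esub> u) N =
      (\<lambda>N\<in>fin_submodules R M. r \<odot>\<^bsub>FactModule M N\<^esub> u N) N"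
    unfolding restrict_apply'[OF N]
    by (rule module_completion_smult_apply[OF N assms(2,1)])
      (rule R.to_ring_completion_apply[OF fin_submodules_annihilator[OF N]])
qed (simp_all only: module_completion_simps(4) restrict_extensional)

lemma continuous_smult_completion:
  "continuous_map (prod_topology (ring_completion_topology R) (module_completion_topology R M))
     (module_completion_topology R M) (\<lambda>(x, u). x \<odot>\<^bsub>module_completion R M\<^esub> u)"
proof -
  let ?S = "fin_submodules R M" and ?C = "module_completion R M"
  let ?P = "prod_topology (ring_completion_topology R) (module_completion_topology R M)"
  have top: "topspace ?P = carrier (ring_completion R) \<times> carrier ?C"
    by simp
  have comp: "continuous_map ?P (discrete_topology (a_rcosets\<^bsub>M\<^esub> N)) (\<lambda>p. (fst p \<odot>\<^bsub>?C\<^esub> snd p) N)"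
    if N: "N \<in> ?S" for N
  proof -
    let ?I = "annihilator R (FactModule M N)"
    let ?D = "discrete_topology ((a_rcosets\<^bsub>R\<^esub> ?I) \<times> (a_rcosets\<^bsub>M\<^esub> N))"
    interpret Q: Module.module R "FactModule M N"
      by (rule FactModule_is_module[OF fin_submodules_submodule[OF N]])
    interpret I: ideal ?I R
      by (rule Q.annihilator_ideal)
    define g where "g = (\<lambda>p. \<Union>r\<in>fst p. r \<odot>\<^bsub>FactModule M N\<^esub> snd p)"
    define h where "h = (\<lambda>p :: ('a set \<Rightarrow> 'a set) \<times> ('c set \<Rightarrow> 'c set). (fst p ?I, snd p N))"
    have h: "continuous_map ?P ?D h"
      unfolding h_def prod_topology_discrete_topology
      by (intro continuous_map_pairedI continuous_map_compose[OF continuous_map_fst, unfolded o_def]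
          continuous_map_compose[OF continuous_map_snd, unfolded o_def]
          continuous_map_lim_component fin_submodules_annihilator N)
    have "g p \<in> a_rcosets\<^bsub>M\<^esub> N" if p: "p \<in> (a_rcosets\<^bsub>R\<^esub> ?I) \<times> (a_rcosets\<^bsub>M\<^esub> N)" for p
    proof -
      have X: "snd p \<in> carrier (FactModule M N)"
        unfolding FactModule_simps using p by (rule mem_Times_iff[THEN iffD1, THEN conjunct2])
      have "fst p \<in> a_rcosets\<^bsub>R\<^esub> ?I"
        using p by (rule mem_Times_iff[THEN iffD1, THEN conjunct1])
      then obtain r where r: "r \<in> carrier R" "fst p = ?I +>\<^bsub>R\<^esub> r"
        unfolding a_rcosets_iff by (elim bexE)
      have "s \<odot>\<^bsub>FactModule M N\<^esub> snd p = r \<odot>\<^bsub>FactModule M N\<^esub> snd p" if "s \<in> ?I +>\<^bsub>R\<^esub> r" for s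
        by (rule Q.annihilator_coset_smult[OF r(1) that X])
      then have "g p = r \<odot>\<^bsub>FactModule M N\<^esub> snd p"
        unfolding g_def r(2) using I.a_rcos_self[OF r(1)] by blast
      then show ?thesis
        using Q.smult_closed[OF r(1) X] unfolding FactModule_simps(1) by simp
    qed
    then have "continuous_map ?D (discrete_topology (a_rcosets\<^bsub>M\<^esub> N)) g"
      unfolding continuous_map_from_discrete_topology topspace_discrete_topology by (rule Pi_I)
    from continuous_map_compose[OF h this]
    have "continuous_map ?P (discrete_topology (a_rcosets\<^bsub>M\<^esub> N)) (g \<circ> h)" .
    moreover have "g \<circ> h = (\<lambda>p. (fst p \<odot>\<^bsub>?C\<^esub> snd p) N)"
      unfolding g_def h_def o_def module_completion_simps(4) restrict_apply'[OF N] fst_conv snd_conv ..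
    ultimately show ?thesis
      by (rule subst[rotated])
  qed
  have into: "fst p \<odot>\<^bsub>?C\<^esub> snd p \<in> lim_carrier M ?S" if p: "p \<in> topspace ?P" for p
  proof -
    have "fst p \<in> carrier (ring_completion R)" "snd p \<in> carrier ?C"
      using p unfolding top mem_Times_iff by blast+
    then have "fst p \<odot>\<^bsub>?C\<^esub> snd p \<in> carrier ?C"
      by (intro module_completion_closed(3))
    then show ?thesis
      unfolding module_completion_simps(1) .
  qed
  have "(\<lambda>p. fst p \<odot>\<^bsub>?C\<^esub> snd p) ` topspace ?P \<subseteq> extensional ?S"
    by (rule image_subsetI, rule lim_carrierD(1), rule into)
  then have "continuous_map ?P (product_topology (\<lambda>N. discrete_topology (a_rcosets\<^bsub>M\<^esub> N)) ?S)
      (\<lambda>p. fst p \<odot>\<^bsub>?C\<^esub> snd p)"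
    unfolding continuous_map_componentwise by (intro conjI ballI comp)
  then have "continuous_map ?P (subtopology
      (product_topology (\<lambda>N. discrete_topology (a_rcosets\<^bsub>M\<^esub> N)) ?S) (lim_carrier M ?S))
      (\<lambda>p. fst p \<odot>\<^bsub>?C\<^esub> snd p)"
    by (rule continuous_map_into_subtopology) (rule Pi_I, rule into)
  then have "continuous_map ?P (module_completion_topology R M) (\<lambda>p. fst p \<odot>\<^bsub>?C\<^esub> snd p)"
    unfolding lim_topology_def[of M ?S] .
  then show ?thesis
    unfolding case_prod_beta' .
qed

lemma smult_completion_unique:
  assumes cont: "\<And>u. u \<in> carrier (module_completion R M) \<Longrightarrow>
      continuous_map (ring_completion_topology R) (module_completion_topology R M) (\<lambda>x. f x u)"
    and ext: "\<And>r u. \<lbrakk>r \<in> carrier R; u \<in> carrier (module_completion R M)\<rbrakk> \<Longrightarrow>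
      f (to_ring_completion R r) u = (\<lambda>N\<in>fin_submodules R M. r \<odot>\<^bsub>FactModule M N\<^esub> u N)"
    and x: "x \<in> carrier (ring_completion R)" and u: "u \<in> carrier (module_completion R M)"
  shows "f x u = x \<odot>\<^bsub>module_completion R M\<^esub> u"
proof (rule forall_in_closure_of_eq[where f = "\<lambda>x. f x u" and g = "\<lambda>x. x \<odot>\<^bsub>module_completion R M\<^esub> u"])
  show "x \<in> ring_completion_topology R closure_of (to_ring_completion R ` carrier R)"
    unfolding R.ring_completion_dense by (rule x)
  show "Hausdorff_space (module_completion_topology R M)"
    by (rule Hausdorff_lim_topology)
  show "continuous_map (ring_completion_topology R) (module_completion_topology R M) (\<lambda>x. f x u)"
    by (rule cont[OF u])
  have "u \<in> topspace (module_completion_topology R M)"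
    using u unfolding topspace_lim_topology module_completion_simps .
  then have "continuous_map (ring_completion_topology R)
      (prod_topology (ring_completion_topology R) (module_completion_topology R M)) (\<lambda>x. (x, u))"
    by (intro continuous_map_pairedI continuous_map_id[unfolded id_def] continuous_map_const[THEN iffD2] disjI2)
  from continuous_map_compose[OF this continuous_smult_completion]
  show "continuous_map (ring_completion_topology R) (module_completion_topology R M)
      (\<lambda>x. x \<odot>\<^bsub>module_completion R M\<^esub> u)"
    unfolding o_def prod.case .
  fix y assume "y \<in> to_ring_completion R ` carrier R"
  then obtain r where "r \<in> carrier R" "y = to_ring_completion R r"
    by (elim imageE)
  then show "f y u = y \<odot>\<^bsub>module_completion R M\<^esub> u"
    using ext[of r u] smult_to_ring_completion[of r u] u by metis
qed

end

end

theory Submission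
  imports Defs
begin

text \<open>Write \<open>A\<close> for the annihilator of \<open>M\<close> in \<open>\<Lambda>\<close>. Since the finite-index ideals are closed under
  intersection, the closure of \<open>A\<close> in the completed ring can be read off one component at a time:
  \<open>x\<close> lies in it iff for every finite-index ideal \<open>J\<close> the component \<open>x J\<close> is the coset of some
  element of \<open>A\<close> (\<open>closure_of_to_lim_image\<close>). Such an \<open>x\<close> acts on every finite quotient
  of \<open>M\<close> through an element of \<open>A\<close>, hence as zero.

  Conversely, let \<open>x\<close> annihilate the completed module, let \<open>J\<close> be a finite-index ideal and let \<open>r\<close>
  represent \<open>x J\<close>. The quotient \<open>M/JM\<close> is finite, because \<open>M\<close> is finitely generated, so it is seen by
  the completion. Therefore \<open>r M \<subseteq> J M\<close>, and the cyclicity of the completed module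
  gives \<open>M = \<Lambda> m + J M\<close> for some \<open>m\<close>. What has to be shown is \<open>r \<in> A + J\<close>.

  Nakayama's lemma for \<open>M / \<Lambda> m\<close> provides \<open>s\<close> with \<open>s \<equiv> 1\<close> modulo \<open>J\<close> and \<open>s M \<subseteq> \<Lambda> m\<close>
  (\<open>nakayama_relative\<close>). Then \<open>s r m \<in> s J M \<subseteq> J m\<close>, say \<open>s r m = j m\<close> with \<open>j \<in> J\<close>. So \<open>s r - j\<close> kills
  \<open>m\<close>, hence also \<open>\<Lambda> m \<supseteq> s M\<close>, which means that \<open>(s r - j) s\<close> lies in \<open>A\<close>; and it is
  congruent to \<open>r\<close> modulo \<open>J\<close>. This is \<open>annihilator_lift_of_cyclic_quotient\<close>. Thus a generator
  of each single quotient \<open>M/JM\<close> is enough, although \<open>M\<close> itself need not be cyclic.\<close>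


section \<open>Closures in inverse limits\<close>

text \<open>A basic open set of the product constrains only finitely many components. When the index
  family is closed under intersection, all of these are determined by the component at a common
  lower bound, so one component suffices to describe neighbourhoods.\<close>

lemma lim_neighbourhood_component:
  assumes "S \<noteq> {}" and inter: "\<And>N N'. \<lbrakk>N \<in> S; N' \<in> S\<rbrakk> \<Longrightarrow> N \<inter> N' \<in> S"
    and T: "openin (lim_topology G S) T" and "\<phi> \<in> T"
  obtains K where "K \<in> S" "\<And>\<psi>. \<lbrakk>\<psi> \<in> lim_carrier G S; \<psi> K = \<phi> K\<rbrakk> \<Longrightarrow> \<psi> \<in> T"
proof -
  obtain U where U: "openin (product_topology (\<lambda>N. discrete_topology (a_rcosets\<^bsub>G\<^esub> N)) S) U"
      "T = U \<inter> lim_carrier G S"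
    using T unfolding lim_topology_def openin_subtopology by blast
  have \<phi>: "\<phi> \<in> lim_carrier G S" "\<phi> \<in> U"
    using \<open>\<phi> \<in> T\<close> U(2) by auto
  then obtain X where X: "\<phi> \<in> (\<Pi>\<^sub>E N\<in>S. X N)" "finite {N \<in> S. X N \<noteq> a_rcosets\<^bsub>G\<^esub> N}"
      "(\<Pi>\<^sub>E N\<in>S. X N) \<subseteq> U"
    using U(1)[unfolded openin_product_topology_alt topspace_discrete_topology, rule_format, OF \<phi>(2)]
    by (elim exE conjE)
  have "\<exists>K\<in>S. \<forall>N\<in>F. K \<subseteq> N" if "finite F" "F \<subseteq> S" for F
    using that
  proof (induction F rule: finite_induct)
    case empty
    then show ?case using \<open>S \<noteq> {}\<close> by auto
  next
    case (insert N F)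
    then obtain K where "K \<in> S" "\<forall>N\<in>F. K \<subseteq> N" by auto
    then show ?case
      using insert.prems inter by (intro bexI[of _ "K \<inter> N"]) auto
  qed
  from this[OF X(2)] obtain K
    where K: "K \<in> S" "\<And>N. \<lbrakk>N \<in> S; X N \<noteq> a_rcosets\<^bsub>G\<^esub> N\<rbrakk> \<Longrightarrow> K \<subseteq> N"
    by auto
  have "\<psi> \<in> T" if \<psi>: "\<psi> \<in> lim_carrier G S" "\<psi> K = \<phi> K" for \<psi>
  proof -
    have "\<psi> N \<in> X N" if N: "N \<in> S" for N
    proof (cases "X N = a_rcosets\<^bsub>G\<^esub> N")
      case True
      then show ?thesis using lim_carrierD(2)[OF \<psi>(1) N] by simp
    next
      case False
      then have "\<psi> N = \<phi> N"
        using lim_carrierD(3)[OF \<psi>(1) K(1) N] lim_carrierD(3)[OF \<phi>(1) K(1) N] K(2)[OF N] \<psi>(2)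
        by simp
      then show ?thesis using PiE_mem[OF X(1) N] by simp
    qed
    then have "\<psi> \<in> (\<Pi>\<^sub>E N\<in>S. X N)"
      using lim_carrierD(1)[OF \<psi>(1)] by (simp add: PiE_iff)
    then show ?thesis using X(3) U(2) \<psi>(1) by blast
  qed
  then show thesis using that K(1) by blast
qed

text \<open>One inclusion uses that prescribing a component is an open condition, the other that these
  conditions form a neighbourhood basis.\<close>

lemma (in abelian_group) closure_of_to_lim_image:
  assumes S: "\<And>N. N \<in> S \<Longrightarrow> additive_subgroup N G"
    and "S \<noteq> {}" and inter: "\<And>N N'. \<lbrakk>N \<in> S; N' \<in> S\<rbrakk> \<Longrightarrow> N \<inter> N' \<in> S"
    and A: "A \<subseteq> carrier G"
  shows "lim_topology G S closure_of (to_lim G S ` A) =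
    {\<phi> \<in> lim_carrier G S. \<forall>N\<in>S. \<exists>a\<in>A. \<phi> N = N +> a}" (is "?L = ?R")
proof (intro equalityI subsetI)
  fix \<phi> assume \<phi>: "\<phi> \<in> ?L"
  then have \<phi>_lim: "\<phi> \<in> lim_carrier G S"
    using closure_of_subset_topspace[of "lim_topology G S"] by auto
  have "\<exists>a\<in>A. \<phi> N = N +> a" if N: "N \<in> S" for N
  proof -
    define T where "T = {\<psi> \<in> topspace (lim_topology G S). \<psi> N \<in> {\<phi> N}}"
    have "openin (lim_topology G S) T"
      unfolding T_def using lim_carrierD(2)[OF \<phi>_lim N]
      by (intro openin_continuous_map_preimage[OF continuous_map_lim_component[OF N]]) simp
    moreover have "\<phi> \<in> T" using \<phi>_lim by (simp add: T_def)
    ultimately have "\<exists>y\<in>to_lim G S ` A. y \<in> T"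
      using \<phi> unfolding in_closure_of by metis
    then obtain a where "a \<in> A" "to_lim G S a N = \<phi> N"
      unfolding T_def by blast
    then show ?thesis using N by (auto simp: to_lim_def)
  qed
  then show "\<phi> \<in> ?R" using \<phi>_lim by blast
next
  fix \<phi> assume \<phi>: "\<phi> \<in> ?R"
  have "\<exists>y\<in>to_lim G S ` A. y \<in> T" if T: "\<phi> \<in> T" "openin (lim_topology G S) T" for T
  proof -
    obtain K where K: "K \<in> S" "\<And>\<psi>. \<lbrakk>\<psi> \<in> lim_carrier G S; \<psi> K = \<phi> K\<rbrakk> \<Longrightarrow> \<psi> \<in> T"
      by (rule lim_neighbourhood_component[OF \<open>S \<noteq> {}\<close> inter T(2,1)]) (assumption+, rule that, blast+)
    obtain a where a: "a \<in> A" "\<phi> K = K +> a"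
      using \<phi> K(1) by auto
    have "to_lim G S a \<in> T"
      using a A K(1) by (intro K(2) to_lim_closed[OF S]) (auto simp: to_lim_def)
    then show ?thesis using a(1) by blast
  qed
  then show "\<phi> \<in> ?L" using \<phi> unfolding in_closure_of by auto
qed

section \<open>Cosets, annihilators and submodules\<close>

lemma to_lim_apply: "N \<in> S \<Longrightarrow> to_lim G S a N = N +>\<^bsub>G\<^esub> a"
  by (simp add: to_lim_def)

lemma annihilatorD:
  assumes "r \<in> annihilator R M"
  shows "r \<in> carrier R" and "m \<in> carrier M \<Longrightarrow> r \<odot>\<^bsub>M\<^esub> m = \<zero>\<^bsub>M\<^esub>"
proof -
  note * = assms[unfolded annihilator_def, THEN CollectD]
  show "r \<in> carrier R" using * by (rule conjunct1)
  show "m \<in> carrier M \<Longrightarrow> r \<odot>\<^bsub>M\<^esub> m = \<zero>\<^bsub>M\<^esub>" using * by (elim conjE bspec)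
qed

lemma (in ring) coset_mult_cong:
  assumes "ideal J R" "a \<in> carrier R" "b \<in> carrier R" "c \<in> carrier R" "d \<in> carrier R"
    and "J +> a = J +> b" "J +> c = J +> d"
  shows "J +> (a \<otimes> c) = J +> (b \<otimes> d)"
  using Quot_coset_simps(2)[OF assms(1,2,4)] Quot_coset_simps(2)[OF assms(1,3,5)] assms(6,7)
  by simp

lemma (in ring) coset_minus_mult:
  assumes J: "ideal J R" and j: "j \<in> J" and a: "a \<in> carrier R" and b: "b \<in> carrier R"
  shows "J +> ((a \<ominus> j) \<otimes> b) = J +> (a \<otimes> b)"
proof -
  interpret J: ideal J R by (rule J)
  have jR: "j \<in> carrier R" using j by (rule J.Icarr)
  have "\<ominus> j \<in> J" using j by (rule J.a_inv_closed)
  moreover have "a \<ominus> j = \<ominus> j \<oplus> a" using a jR by (simp add: minus_eq a_comm)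
  ultimately have "a \<ominus> j \<in> J +> a" unfolding a_r_coset_def' by blast
  then have "J +> a = J +> (a \<ominus> j)" by (rule J.a_repr_independence'[OF _ a])
  then show ?thesis using a b jR by (intro coset_mult_cong[OF J]) simp_all
qed

text \<open>The submodule usually written \<open>J M\<close>. As a span it comes with the minimality property
  by which inclusions of \<open>J M\<close> are reduced to products \<open>j x\<close>, so that no finite sums are
  needed.\<close>

definition ideal_multiple ::
    "('a, 'c) ring_scheme \<Rightarrow> ('a, 'b, 'd) module_scheme \<Rightarrow> 'a set \<Rightarrow> 'b set"
  where "ideal_multiple R M J =
    submodule_span R M {j \<odot>\<^bsub>M\<^esub> x | j x. j \<in> J \<and> x \<in> carrier M}"

context Module.module
begin

lemma submodule_zero_mem: "submodule N R M \<Longrightarrow> \<zero>\<^bsub>M\<^esub> \<in> N"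
  by (rule additive_subgroup.zero_closed[OF submodule_additive_subgroup])

lemma submodule_span_submodule:
  assumes "A \<subseteq> carrier M"
  shows "submodule (submodule_span R M A) R M"
  unfolding submodule_span_def
proof (rule submoduleI)
  show "\<Inter> {N. submodule N R M \<and> A \<subseteq> N} \<subseteq> carrier M"
    using carrier_is_submodule assms by blast
next
  show "\<zero>\<^bsub>M\<^esub> \<in> \<Inter> {N. submodule N R M \<and> A \<subseteq> N}"
    by (intro InterI) (drule CollectD, elim conjE, rule submodule_zero_mem)
next
  fix x assume "x \<in> \<Inter> {N. submodule N R M \<and> A \<subseteq> N}"
  then show "\<ominus>\<^bsub>M\<^esub> x \<in> \<Inter> {N. submodule N R M \<and> A \<subseteq> N}"
    by (intro InterI) (drule InterD, assumption, drule CollectD, elim conjE, rule submoduleE(3))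
next
  fix x y assume "x \<in> \<Inter> {N. submodule N R M \<and> A \<subseteq> N}" "y \<in> \<Inter> {N. submodule N R M \<and> A \<subseteq> N}"
  then show "x \<oplus>\<^bsub>M\<^esub> y \<in> \<Inter> {N. submodule N R M \<and> A \<subseteq> N}"
    by (intro InterI) (drule InterD, assumption, drule InterD, assumption, drule CollectD, elim conjE, rule submoduleE(5))
next
  fix r x assume "r \<in> carrier R" "x \<in> \<Inter> {N. submodule N R M \<and> A \<subseteq> N}"
  then show "r \<odot>\<^bsub>M\<^esub> x \<in> \<Inter> {N. submodule N R M \<and> A \<subseteq> N}"
    by (intro InterI) (drule InterD, assumption, drule CollectD, elim conjE, rule submoduleE(4))
qed

lemma submodule_span_incl: "A \<subseteq> submodule_span R M A"
  by (auto simp: submodule_span_def)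

lemma submodule_span_least:
  assumes "submodule N R M" "A \<subseteq> N"
  shows "submodule_span R M A \<subseteq> N"
  using assms by (auto simp: submodule_span_def)

lemma submodule_mem_carrier: "\<lbrakk>submodule N R M; x \<in> N\<rbrakk> \<Longrightarrow> x \<in> carrier M"
  using submoduleE(1) by blast

lemma zero_submodule: "submodule {\<zero>\<^bsub>M\<^esub>} R M"
  by (rule submoduleI) auto

text \<open>The submodule \<open>P + K a\<close>. The cases of interest are \<open>K\<close> the whole ring, which adjoins \<open>a\<close> to
  \<open>P\<close>, and a proper ideal \<open>K\<close>, which records where the coefficient of \<open>a\<close> lies.\<close>

lemma submodule_add_multiples:
  assumes P: "submodule P R M" and "ideal K R" and a: "a \<in> carrier M"
  shows "submodule {p \<oplus>\<^bsub>M\<^esub> k \<odot>\<^bsub>M\<^esub> a | p k. p \<in> P \<and> k \<in> K} R M"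
proof -
  interpret K: ideal K R by fact
  note P_carr = submodule_mem_carrier[OF P]
  show ?thesis
  proof (rule submoduleI, goal_cases)
    case 1
    then show ?case using a P_carr by auto
  next
    case 2
    then show ?case
      using a submodule_zero_mem[OF P] K.zero_closed
      by (auto intro!: exI[of _ "\<zero>\<^bsub>M\<^esub>"] exI[of _ "\<zero>\<^bsub>R\<^esub>"])
  next
    case (3 y)
    then obtain p k where y: "y = p \<oplus>\<^bsub>M\<^esub> k \<odot>\<^bsub>M\<^esub> a" "p \<in> P" "k \<in> K" by blast
    then have "\<ominus>\<^bsub>M\<^esub> y = \<ominus>\<^bsub>M\<^esub> p \<oplus>\<^bsub>M\<^esub> (\<ominus> k) \<odot>\<^bsub>M\<^esub> a"
      using a P_carr by (simp add: M.minus_add smult_l_minus)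
    then show ?case using y submoduleE(3)[OF P] K.a_inv_closed by blast
  next
    case (4 y z)
    then obtain p k q l where y: "y = p \<oplus>\<^bsub>M\<^esub> k \<odot>\<^bsub>M\<^esub> a" "p \<in> P" "k \<in> K"
        "z = q \<oplus>\<^bsub>M\<^esub> l \<odot>\<^bsub>M\<^esub> a" "q \<in> P" "l \<in> K" by blast
    then have "y \<oplus>\<^bsub>M\<^esub> z = (p \<oplus>\<^bsub>M\<^esub> q) \<oplus>\<^bsub>M\<^esub> (k \<oplus> l) \<odot>\<^bsub>M\<^esub> a"
      using a P_carr by (simp add: smult_l_distr M.a_ac)
    then show ?case using y submoduleE(5)[OF P] K.a_closed by blast
  next
    case (5 r y)
    then obtain p k where y: "y = p \<oplus>\<^bsub>M\<^esub> k \<odot>\<^bsub>M\<^esub> a" "p \<in> P" "k \<in> K" by blast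
    then have "r \<odot>\<^bsub>M\<^esub> y = r \<odot>\<^bsub>M\<^esub> p \<oplus>\<^bsub>M\<^esub> (r \<otimes> k) \<odot>\<^bsub>M\<^esub> a"
      using a P_carr 5 by (simp add: smult_r_distr smult_assoc1)
    then show ?case using y 5 submoduleE(4)[OF P] K.I_l_closed by blast
  qed
qed

lemma submodule_multiples:
  assumes "ideal K R" and a: "a \<in> carrier M"
  shows "submodule {k \<odot>\<^bsub>M\<^esub> a | k. k \<in> K} R M"
proof -
  interpret K: ideal K R by fact
  have "{p \<oplus>\<^bsub>M\<^esub> k \<odot>\<^bsub>M\<^esub> a | p k. p \<in> {\<zero>\<^bsub>M\<^esub>} \<and> k \<in> K} = {k \<odot>\<^bsub>M\<^esub> a | k. k \<in> K}"
    using a by (auto; metis K.Icarr M.l_zero smult_closed)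
  then show ?thesis
    using submodule_add_multiples[OF zero_submodule assms] by simp
qed

lemma submodule_span_singleton:
  assumes a: "a \<in> carrier M"
  shows "submodule_span R M {a} = {r \<odot>\<^bsub>M\<^esub> a | r. r \<in> carrier R}"
proof
  show "submodule_span R M {a} \<subseteq> {r \<odot>\<^bsub>M\<^esub> a | r. r \<in> carrier R}"
    using a smult_one[OF a, symmetric]
    by (intro submodule_span_least submodule_multiples R.oneideal) blast+
  show "{r \<odot>\<^bsub>M\<^esub> a | r. r \<in> carrier R} \<subseteq> submodule_span R M {a}"
    using submoduleE(4)[OF submodule_span_submodule] submodule_span_incl[of "{a}"] a by auto
qed

lemma submodule_smult_vimage:
  assumes Q: "submodule Q R M" and s: "s \<in> carrier R"
  shows "submodule {y \<in> carrier M. s \<odot>\<^bsub>M\<^esub> y \<in> Q} R M"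
proof (rule submoduleI)
  show "{y \<in> carrier M. s \<odot>\<^bsub>M\<^esub> y \<in> Q} \<subseteq> carrier M" by blast
  show "\<zero>\<^bsub>M\<^esub> \<in> {y \<in> carrier M. s \<odot>\<^bsub>M\<^esub> y \<in> Q}"
    using s submodule_zero_mem[OF Q] by simp
next
  fix y assume "y \<in> {y \<in> carrier M. s \<odot>\<^bsub>M\<^esub> y \<in> Q}"
  then show "\<ominus>\<^bsub>M\<^esub> y \<in> {y \<in> carrier M. s \<odot>\<^bsub>M\<^esub> y \<in> Q}"
    using submoduleE(3)[OF Q, of "s \<odot>\<^bsub>M\<^esub> y"] s by (simp add: smult_r_minus)
next
  fix y z assume "y \<in> {y \<in> carrier M. s \<odot>\<^bsub>M\<^esub> y \<in> Q}" "z \<in> {y \<in> carrier M. s \<odot>\<^bsub>M\<^esub> y \<in> Q}"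
  then show "y \<oplus>\<^bsub>M\<^esub> z \<in> {y \<in> carrier M. s \<odot>\<^bsub>M\<^esub> y \<in> Q}"
    using submoduleE(5)[OF Q, of "s \<odot>\<^bsub>M\<^esub> y" "s \<odot>\<^bsub>M\<^esub> z"] s by (simp add: smult_r_distr)
next
  fix r y assume r: "r \<in> carrier R" and y: "y \<in> {y \<in> carrier M. s \<odot>\<^bsub>M\<^esub> y \<in> Q}"
  then have "s \<odot>\<^bsub>M\<^esub> (r \<odot>\<^bsub>M\<^esub> y) = r \<odot>\<^bsub>M\<^esub> (s \<odot>\<^bsub>M\<^esub> y)"
    using s by (simp add: smult_assoc1[symmetric] R.m_comm)
  then show "r \<odot>\<^bsub>M\<^esub> y \<in> {y \<in> carrier M. s \<odot>\<^bsub>M\<^esub> y \<in> Q}"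
    using r y submoduleE(4)[OF Q r, of "s \<odot>\<^bsub>M\<^esub> y"] by simp
qed

lemma ideal_multiple_submodule:
  assumes "ideal J R"
  shows "submodule (ideal_multiple R M J) R M"
  unfolding ideal_multiple_def
  by (rule submodule_span_submodule) (auto intro: ideal.Icarr[OF assms])

lemma ideal_multiple_incl:
  "\<lbrakk>j \<in> J; x \<in> carrier M\<rbrakk> \<Longrightarrow> j \<odot>\<^bsub>M\<^esub> x \<in> ideal_multiple R M J"
  unfolding ideal_multiple_def by (rule subsetD[OF submodule_span_incl]) blast

lemma ideal_multiple_least:
  assumes "submodule N R M" "\<And>j x. \<lbrakk>j \<in> J; x \<in> carrier M\<rbrakk> \<Longrightarrow> j \<odot>\<^bsub>M\<^esub> x \<in> N"
  shows "ideal_multiple R M J \<subseteq> N"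
  unfolding ideal_multiple_def by (rule submodule_span_least) (use assms in auto)

section \<open>Nakayama's lemma relative to a submodule\<close>

text \<open>If \<open>s M \<subseteq> P + R a\<close>, then \<open>s (j x) = j (s x)\<close> lies in \<open>P + J a\<close>. The vectors that \<open>s\<close> sends
  into \<open>P + J a\<close> form a submodule, which therefore contains \<open>J M\<close>.\<close>

lemma smult_ideal_multiple_subset:
  assumes J: "ideal J R" and P: "submodule P R M" and a: "a \<in> carrier M" and s: "s \<in> carrier R"
    and sM: "\<And>y. y \<in> carrier M \<Longrightarrow> \<exists>p\<in>P. \<exists>r\<in>carrier R. s \<odot>\<^bsub>M\<^esub> y = p \<oplus>\<^bsub>M\<^esub> r \<odot>\<^bsub>M\<^esub> a"
    and z: "z \<in> ideal_multiple R M J"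
  shows "\<exists>p\<in>P. \<exists>j\<in>J. s \<odot>\<^bsub>M\<^esub> z = p \<oplus>\<^bsub>M\<^esub> j \<odot>\<^bsub>M\<^esub> a"
proof -
  interpret J: ideal J R by (rule J)
  let ?Q = "{p \<oplus>\<^bsub>M\<^esub> j \<odot>\<^bsub>M\<^esub> a | p j. p \<in> P \<and> j \<in> J}"
  have "ideal_multiple R M J \<subseteq> {y \<in> carrier M. s \<odot>\<^bsub>M\<^esub> y \<in> ?Q}"
  proof (rule ideal_multiple_least)
    show "submodule {y \<in> carrier M. s \<odot>\<^bsub>M\<^esub> y \<in> ?Q} R M"
      by (intro submodule_smult_vimage submodule_add_multiples J P a s)
    fix j x assume j: "j \<in> J" and x: "x \<in> carrier M"
    obtain p r where p: "p \<in> P" "r \<in> carrier R" "s \<odot>\<^bsub>M\<^esub> x = p \<oplus>\<^bsub>M\<^esub> r \<odot>\<^bsub>M\<^esub> a"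
      using sM[OF x] by blast
    have jR: "j \<in> carrier R" using j by (rule J.Icarr)
    have pM: "p \<in> carrier M" by (rule submodule_mem_carrier[OF P p(1)])
    have "s \<odot>\<^bsub>M\<^esub> (j \<odot>\<^bsub>M\<^esub> x) = j \<odot>\<^bsub>M\<^esub> (s \<odot>\<^bsub>M\<^esub> x)"
      using s jR x by (simp add: smult_assoc1[symmetric] R.m_comm)
    also have "\<dots> = j \<odot>\<^bsub>M\<^esub> p \<oplus>\<^bsub>M\<^esub> (j \<otimes> r) \<odot>\<^bsub>M\<^esub> a"
      unfolding p(3) using jR p(2) pM a by (simp add: smult_r_distr smult_assoc1)
    finally show "j \<odot>\<^bsub>M\<^esub> x \<in> {y \<in> carrier M. s \<odot>\<^bsub>M\<^esub> y \<in> ?Q}"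
      using submoduleE(4)[OF P jR p(1)] J.I_r_closed[OF j p(2)] jR x by auto
  qed
  then have "s \<odot>\<^bsub>M\<^esub> z \<in> ?Q" using z by blast
  then show ?thesis by blast
qed

text \<open>The elimination step behind Nakayama's lemma. From \<open>a \<in> P + J M\<close> and \<open>s M \<subseteq> P + R a\<close> one gets
  \<open>s a \<in> P + J a\<close>, that is \<open>(s - j) a \<in> P\<close> for some \<open>j \<in> J\<close>. Multiplying \<open>s M \<subseteq> P + R a\<close> by
  \<open>s - j\<close> then removes \<open>a\<close>.\<close>

lemma nakayama_remove_generator:
  assumes J: "ideal J R" and P: "submodule P R M" and a: "a \<in> carrier M"
    and a_dec: "\<exists>n\<in>P. \<exists>z\<in>ideal_multiple R M J. a = n \<oplus>\<^bsub>M\<^esub> z"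
    and s: "s \<in> carrier R" "J +> s = J +> \<one>"
    and sM: "\<And>y. y \<in> carrier M \<Longrightarrow> \<exists>p\<in>P. \<exists>r\<in>carrier R. s \<odot>\<^bsub>M\<^esub> y = p \<oplus>\<^bsub>M\<^esub> r \<odot>\<^bsub>M\<^esub> a"
  shows "\<exists>t\<in>carrier R. J +> t = J +> \<one> \<and> (\<forall>y\<in>carrier M. t \<odot>\<^bsub>M\<^esub> y \<in> P)"
proof -
  interpret J: ideal J R by (rule J)
  note P_carr = submodule_mem_carrier[OF P]
  obtain n z where n: "n \<in> P" "z \<in> ideal_multiple R M J" "a = n \<oplus>\<^bsub>M\<^esub> z"
    using a_dec by blast
  obtain p j where p: "p \<in> P" "j \<in> J" "s \<odot>\<^bsub>M\<^esub> z = p \<oplus>\<^bsub>M\<^esub> j \<odot>\<^bsub>M\<^esub> a"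
    using smult_ideal_multiple_subset[OF J P a s(1) sM n(2)] by blast
  have jR: "j \<in> carrier R" using p(2) by (rule J.Icarr)
  have zM: "z \<in> carrier M"
    by (rule submodule_mem_carrier[OF ideal_multiple_submodule[OF J] n(2)])
  have sa: "s \<odot>\<^bsub>M\<^esub> a = (s \<odot>\<^bsub>M\<^esub> n \<oplus>\<^bsub>M\<^esub> p) \<oplus>\<^bsub>M\<^esub> j \<odot>\<^bsub>M\<^esub> a"
  proof -
    have "s \<odot>\<^bsub>M\<^esub> a = s \<odot>\<^bsub>M\<^esub> n \<oplus>\<^bsub>M\<^esub> s \<odot>\<^bsub>M\<^esub> z"
      using n(3) smult_r_distr[OF s(1) P_carr[OF n(1)] zM] by simp
    then show ?thesis
      unfolding p(3) using s(1) P_carr[OF n(1)] P_carr[OF p(1)] jR a by (simp add: M.a_assoc)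
  qed
  have "(s \<ominus> j) \<odot>\<^bsub>M\<^esub> a = s \<odot>\<^bsub>M\<^esub> n \<oplus>\<^bsub>M\<^esub> p"
    using s(1) jR a P_carr[OF n(1)] P_carr[OF p(1)] sa
    by (simp add: R.minus_eq smult_l_distr smult_l_minus M.a_assoc M.r_neg)
  then have ua: "(s \<ominus> j) \<odot>\<^bsub>M\<^esub> a \<in> P"
    using submoduleE(5)[OF P submoduleE(4)[OF P s(1) n(1)] p(1)] by simp
  show ?thesis
  proof (intro bexI conjI ballI)
    show t: "(s \<ominus> j) \<otimes> s \<in> carrier R" using s(1) jR by simp
    show "J +> ((s \<ominus> j) \<otimes> s) = J +> \<one>"
      using R.coset_minus_mult[OF J p(2) s(1) s(1)] R.coset_mult_cong[OF J s(1) R.one_closed s(1) R.one_closed s(2) s(2)]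
      by simp
  next
    fix y assume y: "y \<in> carrier M"
    obtain q r where q: "q \<in> P" "r \<in> carrier R" "s \<odot>\<^bsub>M\<^esub> y = q \<oplus>\<^bsub>M\<^esub> r \<odot>\<^bsub>M\<^esub> a"
      using sM[OF y] by blast
    have u: "s \<ominus> j \<in> carrier R" using s(1) jR by simp
    have "((s \<ominus> j) \<otimes> s) \<odot>\<^bsub>M\<^esub> y = (s \<ominus> j) \<odot>\<^bsub>M\<^esub> q \<oplus>\<^bsub>M\<^esub> ((s \<ominus> j) \<otimes> r) \<odot>\<^bsub>M\<^esub> a"
      unfolding smult_assoc1[OF u s(1) y] q(3)
      using u q(2) P_carr[OF q(1)] a by (simp add: smult_r_distr smult_assoc1)
    also have "\<dots> = (s \<ominus> j) \<odot>\<^bsub>M\<^esub> q \<oplus>\<^bsub>M\<^esub> r \<odot>\<^bsub>M\<^esub> ((s \<ominus> j) \<odot>\<^bsub>M\<^esub> a)"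
      using u q(2) a by (simp add: R.m_comm[OF u q(2)] smult_assoc1)
    finally show "((s \<ominus> j) \<otimes> s) \<odot>\<^bsub>M\<^esub> y \<in> P"
      using submoduleE(4,5)[OF P] u q(1,2) ua by simp
  qed
qed

text \<open>Nakayama's lemma for \<open>M/N\<close>: if \<open>M = N + J M\<close>, then some \<open>s\<close> congruent to \<open>1\<close> modulo \<open>J\<close> maps
  \<open>M\<close> into \<open>N\<close>. Generators are removed one at a time, which replaces the determinant of the
  usual proof by an induction.\<close>

lemma nakayama_relative:
  assumes J: "ideal J R" and N: "submodule N R M" and fg: "fin_gen_module R M"
    and dec: "\<And>y. y \<in> carrier M \<Longrightarrow> \<exists>n\<in>N. \<exists>z\<in>ideal_multiple R M J. y = n \<oplus>\<^bsub>M\<^esub> z"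
  obtains s where "s \<in> carrier R" "J +> s = J +> \<one>" "\<And>y. y \<in> carrier M \<Longrightarrow> s \<odot>\<^bsub>M\<^esub> y \<in> N"
proof -
  \<comment> \<open>The submodule \<open>P\<close> grows by the generators already set aside; \<open>B\<close> holds the remaining ones,
    and the last hypothesis says that \<open>P\<close> and \<open>B\<close> together generate \<open>M\<close>.\<close>
  have *: "\<exists>s\<in>carrier R. J +> s = J +> \<one> \<and> (\<forall>y\<in>carrier M. s \<odot>\<^bsub>M\<^esub> y \<in> P)"
    if "finite B" "B \<subseteq> carrier M" "submodule P R M" "N \<subseteq> P"
      "\<And>Q. \<lbrakk>submodule Q R M; P \<subseteq> Q; B \<subseteq> Q\<rbrakk> \<Longrightarrow> carrier M \<subseteq> Q" for B P
    using that
  proof (induction B arbitrary: P rule: finite_induct)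
    case empty
    then have "carrier M \<subseteq> P" by blast
    then show ?case by (intro bexI[of _ \<one>]) auto
  next
    case (insert a B)
    have a: "a \<in> carrier M" using insert.prems by simp
    let ?P = "{p \<oplus>\<^bsub>M\<^esub> r \<odot>\<^bsub>M\<^esub> a | p r. p \<in> P \<and> r \<in> carrier R}"
    have P': "submodule ?P R M"
      by (intro submodule_add_multiples insert.prems R.oneideal a)
    have P_sub: "P \<subseteq> ?P"
    proof
      fix p assume p: "p \<in> P"
      then have "p = p \<oplus>\<^bsub>M\<^esub> \<zero> \<odot>\<^bsub>M\<^esub> a"
        using submodule_mem_carrier[OF insert.prems(2)] a by simp
      then show "p \<in> ?P" using p by blast
    qed
    have a_mem: "a \<in> ?P"
    proof -
      have "a = \<zero>\<^bsub>M\<^esub> \<oplus>\<^bsub>M\<^esub> \<one> \<odot>\<^bsub>M\<^esub> a" using a by simp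
      then show ?thesis using submodule_zero_mem[OF insert.prems(2)] by blast
    qed
    have "\<exists>s\<in>carrier R. J +> s = J +> \<one> \<and> (\<forall>y\<in>carrier M. s \<odot>\<^bsub>M\<^esub> y \<in> ?P)"
    proof (rule insert.IH[OF _ P'])
      show "B \<subseteq> carrier M" using insert.prems(1) by blast
      show "N \<subseteq> ?P" using insert.prems(3) P_sub by (rule subset_trans)
      fix Q assume Q: "submodule Q R M" "?P \<subseteq> Q" "B \<subseteq> Q"
      show "carrier M \<subseteq> Q"
        by (rule insert.prems(4)[OF Q(1) subset_trans[OF P_sub Q(2)]])
          (rule insert_subsetI[OF subsetD[OF Q(2) a_mem] Q(3)])
    qed
    then obtain s where s: "s \<in> carrier R" "J +> s = J +> \<one>"
        and s_mem: "\<And>y. y \<in> carrier M \<Longrightarrow> s \<odot>\<^bsub>M\<^esub> y \<in> ?P"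
      by (elim bexE conjE) (rule that, assumption+, rule bspec)
    have sM: "\<exists>p\<in>P. \<exists>r\<in>carrier R. s \<odot>\<^bsub>M\<^esub> y = p \<oplus>\<^bsub>M\<^esub> r \<odot>\<^bsub>M\<^esub> a"
      if "y \<in> carrier M" for y
      using s_mem[OF that] by blast
    show ?case
      using dec[OF a] insert.prems(3)
      by (intro nakayama_remove_generator[OF J insert.prems(2) a _ s sM]) blast+
  qed
  obtain A where A: "A \<subseteq> carrier M" "finite A" "carrier M = submodule_span R M A"
    using fg unfolding fin_gen_module_def by blast
  have "\<exists>s\<in>carrier R. J +> s = J +> \<one> \<and> (\<forall>y\<in>carrier M. s \<odot>\<^bsub>M\<^esub> y \<in> N)"
    using submodule_span_least A(3) by (intro *[OF A(2,1) N subset_refl]) simp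
  then show thesis using that by blast
qed

section \<open>Finiteness of the quotient by an ideal multiple\<close>

text \<open>Modulo \<open>J M\<close>, the coefficients of a linear combination of the generators matter only modulo
  \<open>J\<close>. Coefficients from a finite set \<open>T\<close> of representatives of the cosets of \<open>J\<close> hence yield
  finitely many vectors that meet all cosets of \<open>J M\<close>.\<close>

lemma ideal_multiple_fin_submodule:
  assumes J: "J \<in> fin_ideals R" and fg: "fin_gen_module R M"
  shows "ideal_multiple R M J \<in> fin_submodules R M"
proof -
  interpret J: ideal J R by (rule fin_ideals_ideal[OF J])
  let ?N = "ideal_multiple R M J"
  have N: "submodule ?N R M" by (rule ideal_multiple_submodule[OF J.ideal_axioms])
  interpret N: abelian_subgroup ?N M by (rule submodule_abelian_subgroup[OF N])
  define rep where "rep X = (SOME t. t \<in> carrier R \<and> X = J +> t)" for X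
  define T where "T = rep ` (a_rcosets J)"
  have "finite T"
    using J unfolding T_def by (auto simp: fin_ideals_def FactRing_def)
  have T: "\<exists>t\<in>T. t \<in> carrier R \<and> r \<ominus> t \<in> J" if r: "r \<in> carrier R" for r
  proof -
    have "rep (J +> r) \<in> carrier R \<and> J +> r = J +> rep (J +> r)"
      unfolding rep_def by (rule someI[of _ r]) (use r in simp)
    moreover have "rep (J +> r) \<in> T"
      unfolding T_def using R.a_rcosetsI[OF J.a_subset r] by blast
    ultimately show ?thesis
      using J.a_rcos_self[OF r] J.a_rcos_module_imp[of "rep (J +> r)" r]
      by (auto simp: R.minus_eq)
  qed
  have *: "\<exists>F. finite F \<and> F \<subseteq> carrier M \<and> (\<forall>y\<in>submodule_span R M A. \<exists>f\<in>F. \<exists>z\<in>?N. y = z \<oplus>\<^bsub>M\<^esub> f)"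
    if "finite A" "A \<subseteq> carrier M" for A
    using that
  proof (induction A rule: finite_induct)
    case empty
    have "submodule_span R M {} \<subseteq> {\<zero>\<^bsub>M\<^esub>}"
      by (rule submodule_span_least[OF zero_submodule]) simp
    then have "\<forall>y\<in>submodule_span R M {}. \<exists>f\<in>{\<zero>\<^bsub>M\<^esub>}. \<exists>z\<in>?N. y = z \<oplus>\<^bsub>M\<^esub> f"
      using submodule_zero_mem[OF N] by (auto intro!: bexI[of _ "\<zero>\<^bsub>M\<^esub>"])
    then show ?case by (intro exI[of _ "{\<zero>\<^bsub>M\<^esub>}"]) simp
  next
    case (insert a A)
    have a: "a \<in> carrier M" and A: "A \<subseteq> carrier M" using insert.prems by auto
    obtain F where F: "finite F" "F \<subseteq> carrier M"
        "\<And>y. y \<in> submodule_span R M A \<Longrightarrow> \<exists>f\<in>F. \<exists>z\<in>?N. y = z \<oplus>\<^bsub>M\<^esub> f"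
      using insert.IH[OF A] by blast
    let ?P = "submodule_span R M A"
    let ?F = "(\<lambda>(f, t). f \<oplus>\<^bsub>M\<^esub> t \<odot>\<^bsub>M\<^esub> a) ` (F \<times> (T \<inter> carrier R))"
    have P: "submodule ?P R M" by (rule submodule_span_submodule[OF A])
    have "submodule_span R M (insert a A) \<subseteq> {p \<oplus>\<^bsub>M\<^esub> r \<odot>\<^bsub>M\<^esub> a | p r. p \<in> ?P \<and> r \<in> carrier R}"
    proof (rule submodule_span_least)
      have "p = p \<oplus>\<^bsub>M\<^esub> \<zero> \<odot>\<^bsub>M\<^esub> a \<and> p \<in> ?P" if "p \<in> A" for p
        using that a A submodule_span_incl[of A] by auto
      moreover have "a = \<zero>\<^bsub>M\<^esub> \<oplus>\<^bsub>M\<^esub> \<one> \<odot>\<^bsub>M\<^esub> a" using a by simp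
      ultimately show "insert a A \<subseteq> {p \<oplus>\<^bsub>M\<^esub> r \<odot>\<^bsub>M\<^esub> a | p r. p \<in> ?P \<and> r \<in> carrier R}"
        using submodule_zero_mem[OF P] by blast
    qed (intro submodule_add_multiples P a R.oneideal)
    moreover have "\<exists>f\<in>?F. \<exists>z\<in>?N. p \<oplus>\<^bsub>M\<^esub> r \<odot>\<^bsub>M\<^esub> a = z \<oplus>\<^bsub>M\<^esub> f"
      if p: "p \<in> ?P" and r: "r \<in> carrier R" for p r
    proof -
      obtain f z where f: "f \<in> F" "z \<in> ?N" "p = z \<oplus>\<^bsub>M\<^esub> f" using F(3)[OF p] by blast
      obtain t where t: "t \<in> T" "t \<in> carrier R" "r \<ominus> t \<in> J" using T[OF r] by blast
      have carr: "f \<in> carrier M" "z \<in> carrier M"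
        using f F(2) submodule_mem_carrier[OF N] by auto
      have "r = (r \<ominus> t) \<oplus> t" using r t(2) by (simp add: R.minus_eq R.a_assoc R.l_neg)
      then have "r \<odot>\<^bsub>M\<^esub> a = (r \<ominus> t) \<odot>\<^bsub>M\<^esub> a \<oplus>\<^bsub>M\<^esub> t \<odot>\<^bsub>M\<^esub> a"
        using smult_l_distr[of "r \<ominus> t" t a] r t(2) a by simp
      then have "p \<oplus>\<^bsub>M\<^esub> r \<odot>\<^bsub>M\<^esub> a = (z \<oplus>\<^bsub>M\<^esub> (r \<ominus> t) \<odot>\<^bsub>M\<^esub> a) \<oplus>\<^bsub>M\<^esub> (f \<oplus>\<^bsub>M\<^esub> t \<odot>\<^bsub>M\<^esub> a)"
        using carr r t(2) a f(3) by (simp add: M.a_ac)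
      moreover have "z \<oplus>\<^bsub>M\<^esub> (r \<ominus> t) \<odot>\<^bsub>M\<^esub> a \<in> ?N"
        by (intro submoduleE(5)[OF N] f ideal_multiple_incl t a)
      ultimately show ?thesis using f(1) t(1,2) by force
    qed
    moreover have "finite ?F" using F(1) \<open>finite T\<close> by simp
    moreover have "?F \<subseteq> carrier M" using F(2) a by auto
    ultimately show ?case by (intro exI[of _ ?F]) blast
  qed
  obtain A where A: "A \<subseteq> carrier M" "finite A" "carrier M = submodule_span R M A"
    using fg unfolding fin_gen_module_def by blast
  obtain F where F: "finite F" "F \<subseteq> carrier M"
      "\<And>y. y \<in> carrier M \<Longrightarrow> \<exists>f\<in>F. \<exists>z\<in>?N. y = z \<oplus>\<^bsub>M\<^esub> f"
    using *[OF A(2,1)] unfolding A(3)[symmetric] by (elim exE conjE) (rule that, assumption+, rule bspec)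
  have "a_rcosets\<^bsub>M\<^esub> ?N \<subseteq> (\<lambda>f. ?N +>\<^bsub>M\<^esub> f) ` F"
  proof
    fix X assume "X \<in> a_rcosets\<^bsub>M\<^esub> ?N"
    then obtain y where y: "y \<in> carrier M" "X = ?N +>\<^bsub>M\<^esub> y" unfolding a_rcosets_iff by blast
    obtain f z where f: "f \<in> F" "z \<in> ?N" "y = z \<oplus>\<^bsub>M\<^esub> f" using F(3)[OF y(1)] by blast
    then have "y \<in> ?N +>\<^bsub>M\<^esub> f" by (auto simp: a_r_coset_def r_coset_def)
    then have "X = ?N +>\<^bsub>M\<^esub> f"
      using y(2) f(1) F(2) N.a_repr_independence' by blast
    then show "X \<in> (\<lambda>f. ?N +>\<^bsub>M\<^esub> f) ` F" using f(1) by blast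
  qed
  then have "finite (a_rcosets\<^bsub>M\<^esub> ?N)"
    by (rule finite_subset[OF _ finite_imageI[OF F(1)]])
  then show ?thesis
    unfolding fin_submodules_def FactModule_simps using N by (intro CollectI conjI)
qed

section \<open>Annihilators of cyclic quotients\<close>

text \<open>When \<open>M/JM\<close> is generated by one element, its annihilator is no larger than \<open>A + J\<close>, where
  \<open>A\<close> is the annihilator of \<open>M\<close>. For a cyclic module this is clear from \<open>M = R/A\<close>; here the
  element \<open>s\<close> of Nakayama's lemma, congruent to \<open>1\<close> modulo \<open>J\<close>, moves all of \<open>M\<close> into the
  cyclic submodule.\<close>

lemma annihilator_lift_of_cyclic_quotient:
  assumes J: "ideal J R" and fg: "fin_gen_module R M"
    and m: "m \<in> carrier M"
    and gen: "\<And>y. y \<in> carrier M \<Longrightarrow> \<exists>r\<in>carrier R. \<exists>z\<in>ideal_multiple R M J. y = r \<odot>\<^bsub>M\<^esub> m \<oplus>\<^bsub>M\<^esub> z"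
    and r: "r \<in> carrier R" "\<And>y. y \<in> carrier M \<Longrightarrow> r \<odot>\<^bsub>M\<^esub> y \<in> ideal_multiple R M J"
  shows "\<exists>i\<in>annihilator R M. J +> r = J +> i"
proof -
  interpret J: ideal J R by (rule J)
  have sub: "submodule {k \<odot>\<^bsub>M\<^esub> m | k. k \<in> carrier R} R M"
    by (rule submodule_multiples[OF R.oneideal m])
  have dec: "\<exists>n\<in>{k \<odot>\<^bsub>M\<^esub> m | k. k \<in> carrier R}. \<exists>z\<in>ideal_multiple R M J. y = n \<oplus>\<^bsub>M\<^esub> z"
    if "y \<in> carrier M" for y
    using gen[OF that] by blast
  obtain s where s: "s \<in> carrier R" "J +> s = J +> \<one>"
      "\<And>y. y \<in> carrier M \<Longrightarrow> s \<odot>\<^bsub>M\<^esub> y \<in> {k \<odot>\<^bsub>M\<^esub> m | k. k \<in> carrier R}"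
    by (rule nakayama_relative[OF J sub fg dec]) (assumption, rule that)
  have sM: "\<exists>p\<in>{\<zero>\<^bsub>M\<^esub>}. \<exists>k\<in>carrier R. s \<odot>\<^bsub>M\<^esub> y = p \<oplus>\<^bsub>M\<^esub> k \<odot>\<^bsub>M\<^esub> m" if "y \<in> carrier M" for y
    using s(3)[OF that] m by auto
  obtain j where j: "j \<in> J" "s \<odot>\<^bsub>M\<^esub> (r \<odot>\<^bsub>M\<^esub> m) = \<zero>\<^bsub>M\<^esub> \<oplus>\<^bsub>M\<^esub> j \<odot>\<^bsub>M\<^esub> m"
    using smult_ideal_multiple_subset[OF J zero_submodule m s(1) sM r(2)[OF m]] by blast
  have jR: "j \<in> carrier R" using j(1) by (rule J.Icarr)
  \<comment> \<open>This element kills \<open>m\<close>; the further factor \<open>s\<close> below makes it kill \<open>M\<close>.\<close>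
  let ?u = "s \<otimes> r \<ominus> j"
  have u: "?u \<in> carrier R" using s(1) r(1) jR by simp
  have um: "?u \<odot>\<^bsub>M\<^esub> m = \<zero>\<^bsub>M\<^esub>"
    using s(1) r(1) jR m j(2)
    by (simp add: R.minus_eq smult_l_distr smult_l_minus smult_assoc1 M.r_neg)
  have "?u \<otimes> s \<in> annihilator R M"
    unfolding annihilator_def
  proof (intro CollectI conjI ballI)
    fix y assume y: "y \<in> carrier M"
    obtain k where k: "k \<in> carrier R" "s \<odot>\<^bsub>M\<^esub> y = k \<odot>\<^bsub>M\<^esub> m" using s(3)[OF y] by blast
    have "(?u \<otimes> s) \<odot>\<^bsub>M\<^esub> y = (?u \<otimes> k) \<odot>\<^bsub>M\<^esub> m"
      using u s(1) k y m by (simp add: smult_assoc1)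
    also have "\<dots> = k \<odot>\<^bsub>M\<^esub> (?u \<odot>\<^bsub>M\<^esub> m)"
      using u k(1) m by (simp add: R.m_comm[OF u k(1)] smult_assoc1)
    finally show "(?u \<otimes> s) \<odot>\<^bsub>M\<^esub> y = \<zero>\<^bsub>M\<^esub>" using um k(1) by simp
  qed (use u s(1) in simp)
  moreover have "J +> r = J +> (?u \<otimes> s)"
  proof -
    have "J +> (s \<otimes> r) = J +> (\<one> \<otimes> r)"
      by (rule R.coset_mult_cong[OF J s(1) R.one_closed r(1) r(1) s(2) refl])
    then have "J +> ((s \<otimes> r) \<otimes> s) = J +> (r \<otimes> \<one>)"
      using s(1,2) r(1) by (intro R.coset_mult_cong[OF J]) simp_all
    then show ?thesis
      using R.coset_minus_mult[OF J j(1) R.m_closed[OF s(1) r(1)] s(1)] r(1) by simp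
  qed
  ultimately show ?thesis by blast
qed

section \<open>Finite quotients of the completed module\<close>

lemma module_completion_smult_coset:
  assumes N: "N \<in> fin_submodules R M" and u: "u \<in> carrier (module_completion R M)"
    and r: "r \<in> carrier R" "x (annihilator R (FactModule M N)) = annihilator R (FactModule M N) +> r"
    and a: "a \<in> carrier M" "u N = N +>\<^bsub>M\<^esub> a"
  shows "(x \<odot>\<^bsub>module_completion R M\<^esub> u) N = N +>\<^bsub>M\<^esub> (r \<odot>\<^bsub>M\<^esub> a)"
  unfolding module_completion_smult_apply[of N u r x, OF N u r] a(2)
  by (rule FactModule_smult[OF fin_submodules_submodule[OF N] r(1) a(1)])

lemma module_completion_zero_apply:
  "N \<in> fin_submodules R M \<Longrightarrow> \<zero>\<^bsub>module_completion R M\<^esub> N = N"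
  by (simp only: module_completion_simps(2) restrict_apply' FactModule_simps(2))

lemma to_lim_module_completion:
  "y \<in> carrier M \<Longrightarrow> to_lim M (fin_submodules R M) y \<in> carrier (module_completion R M)"
  unfolding module_completion_simps by (rule M.to_lim_closed[OF fin_submodules_subgroup])

text \<open>Every vector of \<open>M\<close> is, in the completion, a multiple \<open>x u\<close> of the generator \<open>u\<close>. In the
  component at \<open>N\<close> the scalar \<open>x\<close> acts like an element of \<open>R\<close>, so the component of \<open>u\<close> generates
  \<open>M/N\<close>.\<close>

lemma cyclic_completion_quotient:
  assumes cyc: "cyclic_module (ring_completion R) (module_completion R M)"
    and N: "N \<in> fin_submodules R M"
  obtains m where "m \<in> carrier M"
    "\<And>y. y \<in> carrier M \<Longrightarrow> \<exists>r\<in>carrier R. \<exists>z\<in>N. y = r \<odot>\<^bsub>M\<^esub> m \<oplus>\<^bsub>M\<^esub> z"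
proof -
  interpret C: Module.module "ring_completion R" "module_completion R M"
    by (rule module_completion_module)
  have subN: "submodule N R M" by (rule fin_submodules_submodule[OF N])
  interpret N: abelian_subgroup N M by (rule submodule_abelian_subgroup[OF subN])
  obtain u where u: "u \<in> carrier (module_completion R M)"
      "carrier (module_completion R M) = submodule_span (ring_completion R) (module_completion R M) {u}"
    using cyc unfolding cyclic_module_def by blast
  obtain m where m: "m \<in> carrier M" "u N = N +>\<^bsub>M\<^esub> m"
    by (rule module_completion_coset[OF u(1) N])
  have "\<exists>r\<in>carrier R. \<exists>z\<in>N. y = r \<odot>\<^bsub>M\<^esub> m \<oplus>\<^bsub>M\<^esub> z" if y: "y \<in> carrier M" for y
  proof -
    obtain x where x: "x \<in> carrier (ring_completion R)"
        "to_lim M (fin_submodules R M) y = x \<odot>\<^bsub>module_completion R M\<^esub> u"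
      using to_lim_module_completion[OF y]
      unfolding u(2) C.submodule_span_singleton[OF u(1)] by (elim CollectE exE conjE) (rule that)
    obtain r where r: "r \<in> carrier R"
        "x (annihilator R (FactModule M N)) = annihilator R (FactModule M N) +> r"
      by (rule R.ring_completion_coset[OF x(1) fin_submodules_annihilator[OF N]])
    have "N +>\<^bsub>M\<^esub> y = (x \<odot>\<^bsub>module_completion R M\<^esub> u) N"
      unfolding x(2)[symmetric] by (rule to_lim_apply[OF N, symmetric])
    also have "\<dots> = N +>\<^bsub>M\<^esub> (r \<odot>\<^bsub>M\<^esub> m)"
      by (rule module_completion_smult_coset[of N u r x, OF N u(1) r m])
    finally have "y \<in> N +>\<^bsub>M\<^esub> (r \<odot>\<^bsub>M\<^esub> m)" using N.a_rcos_self[OF y] by simp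
    then obtain z where "z \<in> N" "y = z \<oplus>\<^bsub>M\<^esub> r \<odot>\<^bsub>M\<^esub> m" by (auto simp: a_r_coset_def r_coset_def)
    then show ?thesis
      using r(1) m(1) submodule_mem_carrier[OF subN] by (auto simp: M.a_comm)
  qed
  then show thesis using that m(1) by blast
qed

text \<open>The action on \<open>M/N\<close> is defined through the component of \<open>x\<close> at the annihilator of \<open>M/N\<close>.
  As \<open>J M \<subseteq> N\<close>, this annihilator contains \<open>J\<close>, so a representative of \<open>x J\<close> may be used
  instead.\<close>

lemma annihilator_completion_component:
  assumes x: "x \<in> annihilator (ring_completion R) (module_completion R M)"
    and J: "J \<in> fin_ideals R" and r: "r \<in> carrier R" "x J = J +> r"
    and N: "N \<in> fin_submodules R M"
    and JN: "\<And>j y. \<lbrakk>j \<in> J; y \<in> carrier M\<rbrakk> \<Longrightarrow> j \<odot>\<^bsub>M\<^esub> y \<in> N"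
    and y: "y \<in> carrier M"
  shows "r \<odot>\<^bsub>M\<^esub> y \<in> N"
proof -
  let ?I = "annihilator R (FactModule M N)" and ?y = "to_lim M (fin_submodules R M) y"
  have subN: "submodule N R M" by (rule fin_submodules_submodule[OF N])
  interpret N: abelian_subgroup N M by (rule submodule_abelian_subgroup[OF subN])
  interpret I: ideal ?I R by (rule fin_ideals_ideal[OF fin_submodules_annihilator[OF N]])
  have "J \<subseteq> ?I"
  proof
    fix j assume j: "j \<in> J"
    have jR: "j \<in> carrier R" using j by (rule ideal.Icarr[OF fin_ideals_ideal[OF J]])
    have "j \<odot>\<^bsub>FactModule M N\<^esub> (N +>\<^bsub>M\<^esub> a) = N" if "a \<in> carrier M" for a
      unfolding FactModule_smult[OF subN jR that] using JN[OF j that] by (rule N.a_rcos_const)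
    then show "j \<in> ?I"
      unfolding annihilator_def using jR by (auto simp: a_rcosets_iff simp del: FactModule_simps(4))
  qed
  have xR: "x \<in> carrier (ring_completion R)" by (rule annihilatorD(1)[OF x])
  have xI: "x ?I = ?I +> r"
    using lim_carrierD(3)[OF xR[unfolded ring_completion_simps] J fin_submodules_annihilator[OF N] \<open>J \<subseteq> ?I\<close>]
      R.transition_coset[OF fin_ideals_subgroup[OF J] I.additive_subgroup_axioms \<open>J \<subseteq> ?I\<close> r(1)]
    unfolding r(2) by simp
  have "N = (x \<odot>\<^bsub>module_completion R M\<^esub> ?y) N"
    unfolding annihilatorD(2)[OF x to_lim_module_completion[OF y]]
    by (rule module_completion_zero_apply[OF N, symmetric])
  also have "\<dots> = N +>\<^bsub>M\<^esub> (r \<odot>\<^bsub>M\<^esub> y)"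
    by (rule module_completion_smult_coset[of N ?y r x,
          OF N to_lim_module_completion[OF y] r(1) xI y to_lim_apply[OF N]])
  finally show ?thesis using N.a_rcos_self[of "r \<odot>\<^bsub>M\<^esub> y"] r(1) y by simp
qed

lemma annihilator_completionI:
  assumes x: "x \<in> carrier (ring_completion R)"
    and comp: "\<And>I. I \<in> fin_ideals R \<Longrightarrow> \<exists>i\<in>annihilator R M. x I = I +> i"
  shows "x \<in> annihilator (ring_completion R) (module_completion R M)"
proof -
  interpret C: Module.module "ring_completion R" "module_completion R M"
    by (rule module_completion_module)
  have "x \<odot>\<^bsub>module_completion R M\<^esub> u = \<zero>\<^bsub>module_completion R M\<^esub>"
    if u: "u \<in> carrier (module_completion R M)" for u
  proof (rule module_completion_eqI)
    fix N assume N: "N \<in> fin_submodules R M"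
    have subN: "submodule N R M" by (rule fin_submodules_submodule[OF N])
    interpret N: abelian_subgroup N M by (rule submodule_abelian_subgroup[OF subN])
    obtain i where i: "i \<in> annihilator R M"
        "x (annihilator R (FactModule M N)) = annihilator R (FactModule M N) +> i"
      using comp[OF fin_submodules_annihilator[OF N]] by blast
    have iR: "i \<in> carrier R" by (rule annihilatorD(1)[OF i(1)])
    obtain m where m: "m \<in> carrier M" "u N = N +>\<^bsub>M\<^esub> m"
      by (rule module_completion_coset[OF u N])
    have "(x \<odot>\<^bsub>module_completion R M\<^esub> u) N = N +>\<^bsub>M\<^esub> (i \<odot>\<^bsub>M\<^esub> m)"
      by (rule module_completion_smult_coset[of N u i x, OF N u iR i(2) m])
    also have "\<dots> = N"
      unfolding annihilatorD(2)[OF i(1) m(1)] by (rule N.a_rcos_const[OF submodule_zero_mem[OF subN]])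
    finally show "(x \<odot>\<^bsub>module_completion R M\<^esub> u) N = \<zero>\<^bsub>module_completion R M\<^esub> N"
      unfolding module_completion_zero_apply[OF N] .
  qed (rule C.smult_closed[OF x u], rule C.M.zero_closed)
  then show ?thesis using x unfolding annihilator_def by blast
qed

end

section \<open>The annihilator of the completed module\<close>

theorem proposition3p3:
  fixes \<Lambda> :: "('a, 'c) ring_scheme" and M :: "('a, 'b, 'd) module_scheme"
  assumes "noetherian_domain \<Lambda>"
    and "fin_gen_ring \<Lambda>"
    and "Module.module \<Lambda> M"
    and "fin_gen_module \<Lambda> M"
    and "cyclic_module (ring_completion \<Lambda>) (module_completion \<Lambda> M)"
  shows "ring_completion_topology \<Lambda> closure_of (to_ring_completion \<Lambda> ` annihilator \<Lambda> M) =
    annihilator (ring_completion \<Lambda>) (module_completion \<Lambda> M)"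
proof -
  interpret Module.module \<Lambda> M by fact
  have closure: "ring_completion_topology \<Lambda> closure_of (to_ring_completion \<Lambda> ` annihilator \<Lambda> M) =
      {x \<in> carrier (ring_completion \<Lambda>). \<forall>J\<in>fin_ideals \<Lambda>. \<exists>i\<in>annihilator \<Lambda> M. x J = J +>\<^bsub>\<Lambda>\<^esub> i}"
    unfolding ring_completion_simps
    using R.carrier_fin_ideals
    by (intro R.closure_of_to_lim_image fin_ideals_subgroup R.fin_ideals_Int)
      (blast dest: annihilatorD(1))+
  show ?thesis
    unfolding closure
  proof (intro equalityI subsetI)
    fix x assume "x \<in> {x \<in> carrier (ring_completion \<Lambda>).
        \<forall>J\<in>fin_ideals \<Lambda>. \<exists>i\<in>annihilator \<Lambda> M. x J = J +>\<^bsub>\<Lambda>\<^esub> i}"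
    then show "x \<in> annihilator (ring_completion \<Lambda>) (module_completion \<Lambda> M)"
      by (intro annihilator_completionI) blast+
  next
    fix x assume x: "x \<in> annihilator (ring_completion \<Lambda>) (module_completion \<Lambda> M)"
    have xR: "x \<in> carrier (ring_completion \<Lambda>)" by (rule annihilatorD(1)[OF x])
    have "\<exists>i\<in>annihilator \<Lambda> M. x J = J +>\<^bsub>\<Lambda>\<^esub> i" if J: "J \<in> fin_ideals \<Lambda>" for J
    proof -
      have N: "ideal_multiple \<Lambda> M J \<in> fin_submodules \<Lambda> M"
        by (rule ideal_multiple_fin_submodule[OF J assms(4)])
      obtain m where m: "m \<in> carrier M"
          "\<And>y. y \<in> carrier M \<Longrightarrow>
            \<exists>r\<in>carrier \<Lambda>. \<exists>z\<in>ideal_multiple \<Lambda> M J. y = r \<odot>\<^bsub>M\<^esub> m \<oplus>\<^bsub>M\<^esub> z"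
        by (rule cyclic_completion_quotient[OF assms(5) N]) (rule that)
      obtain r where r: "r \<in> carrier \<Lambda>" "x J = J +>\<^bsub>\<Lambda>\<^esub> r"
        by (rule R.ring_completion_coset[OF xR J])
      have "r \<odot>\<^bsub>M\<^esub> y \<in> ideal_multiple \<Lambda> M J" if "y \<in> carrier M" for y
        by (rule annihilator_completion_component[OF x J r N ideal_multiple_incl that])
      then show ?thesis
        unfolding r(2)
        by (intro annihilator_lift_of_cyclic_quotient[OF fin_ideals_ideal[OF J] assms(4) m r(1)])
    qed
    then show "x \<in> {x \<in> carrier (ring_completion \<Lambda>).
        \<forall>J\<in>fin_ideals \<Lambda>. \<exists>i\<in>annihilator \<Lambda> M. x J = J +>\<^bsub>\<Lambda>\<^esub> i}"
      using xR by blast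
  qed
qed

end
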